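(* For each realisation $c$ of $C^Q$, suppose $\sigma^2(c)>0$ and let $N(c)$ be a normally distributed random variable with mean $\sum_{j=1}^d(\xi_j-1)\,p_j(c)$ and variance $\sigma^2(c)$. Let $N$ be the mixture with $N=N(c)$ with probability $\mathbb{P}(C^Q=c)$, so that $\mathbb{P}(N>0)=\sum_c\mathbb{P}(C^Q=c)\,\mathbb{P}(N(c)>0)$. Then $$\left|\mathbb{P}(P^Q<1)-\mathbb{P}(N>0)\right|\le 9.4\sum_c\mathbb{P}(C^Q=c)\sum_{j=1}^d\mathbb{E}\left[|Z_j(c)|^3\right],$$ where $Z_j(c):=\frac{1}{\sigma(c)}(\xi_j-1)(I_j-p_j(c))$ and the expectation $\mathbb{E}[|Z_j(c)|^3]$ is taken conditionally on $C^Q=c$ (that is, with $I_j$ Bernoulli with success probability $p_j(c)$).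
   Context: There are $q$ agents and $d$ objects. Each object $j\in\{1,\dots,d\}$ has a premium rate $c_j>0$ and a mean claim size $\mu_j>0$ (finite), and $\lambda>0$ is the common claim arrival intensity. Put $\xi_j:=\frac{c_j}{\lambda\mu_j}$. These are deterministic constants. The random bipartite network between agents and objects is a stochastic blockmodel with $K$ types of agents and $L$ types of objects. Agent $i$ has random type $s(i)$ with $\mathbb{P}(s(i)=k)=w_k$, $k=1,\dots,K$, $\sum_{k=1}^K w_k=1$; object $j$ has random type $t(j)$ with $\mathbb{P}(t(j)=l)=v_l$, $l=1,\dots,L$, $\sum_{l=1}^L v_l=1$; all types are independent. Edges occur only between agents and objects; given all types, the edge indicators $\mathbf{1}\{i\sim j\}$ are mutually independent and $\mathbb{P}(i\sim j\mid s(i)=k,t(j)=l)=p_{kl}$. Let $Q\subseteq\{1,\dots,q\}$ be a nonempty set of agents. Define $I_j:=\mathbf{1}\{Q\sim j\}:=\max_{i\in Q}\mathbf{1}\{i\sim j\}$ and the network Pollaczek–Khintchine random variable $$P^Q:=\lambda\,\frac{\sum_{j=1}^d I_j}{\sum_{j=1}^d I_j\,c_j/\mu_j}=\frac{\sum_{j=1}^d I_j}{\sum_{j=1}^d\xi_j I_j},\qquad \tfrac00:=0.$$ Let $C^Q:=\{s(i)\}_{i\in Q}\cup\{t(j)\}_{j=1}^d$ be the random type configuration on $Q$ and all objects (recorded as the tuple of types), and let $c$ denote a realisation of $C^Q$; sums over $c$ run over all realisations. For a realisation $c$, with types $s(i)$, $t(j)$ given by $c$, let $$p_j(c):=\mathbb{P}(Q\sim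 j\mid C^Q=c)=1-\prod_{i\in Q}\bigl(1-p_{s(i)t(j)}\bigr),\qquad \sigma^2(c):=\sum_{j=1}^d(\xi_j-1)^2\,p_j(c)\,(1-p_j(c)),$$ and $\sigma(c):=\sqrt{\sigma^2(c)}$. *)

theory Defs
  imports "HOL-Probability.Probability"
begin

text \<open>
  Agents are \<open>{1..q}\<close>, objects are \<open>{1..d}\<close>, agent types are \<open>{1..K}\<close> and object types
  are \<open>{1..L}\<close>. The random types are \<open>s i\<close> and \<open>t j\<close>, and \<open>E i j\<close> is the event \<open>i \<sim> j\<close>.
\<close>

type_synonym type_config = "(nat \<Rightarrow> nat) \<times> (nat \<Rightarrow> nat)"

text \<open>
  The tuple of types \<open>C\<^sup>Q\<close>; the functions are \<open>undefined\<close> off \<open>Q\<close> and off the objects, so that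
  equality of configurations is equality of tuples. \<open>config s t {1..q} d\<close> records all types.
\<close>

definition config ::
  "(nat \<Rightarrow> 'w \<Rightarrow> nat) \<Rightarrow> (nat \<Rightarrow> 'w \<Rightarrow> nat) \<Rightarrow> nat set \<Rightarrow> nat \<Rightarrow> 'w \<Rightarrow> type_config" where
  "config s t Q d \<omega> = (restrict (\<lambda>i. s i \<omega>) Q, restrict (\<lambda>j. t j \<omega>) {1..d})"

definition config_prob ::
  "'w measure \<Rightarrow> (nat \<Rightarrow> 'w \<Rightarrow> nat) \<Rightarrow> (nat \<Rightarrow> 'w \<Rightarrow> nat) \<Rightarrow> nat set \<Rightarrow> nat \<Rightarrow> type_config \<Rightarrow> real" where
  "config_prob M s t Q d c = measure M {\<omega> \<in> space M. config s t Q d \<omega> = c}"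

text \<open>
  Only configurations of positive probability count as realisations: these are the ones on which
  one can condition, and the others have weight zero in every sum.
\<close>

definition realisations ::
  "'w measure \<Rightarrow> (nat \<Rightarrow> 'w \<Rightarrow> nat) \<Rightarrow> (nat \<Rightarrow> 'w \<Rightarrow> nat) \<Rightarrow> nat \<Rightarrow> nat \<Rightarrow> nat set \<Rightarrow> nat
    \<Rightarrow> type_config set" where
  "realisations M s t K L Q d =
    {c \<in> (Q \<rightarrow>\<^sub>E {1..K}) \<times> ({1..d} \<rightarrow>\<^sub>E {1..L}). config_prob M s t Q d c > 0}"

text \<open>The conditional probability measure given \<open>C\<^sup>Q = c\<close>.\<close>

definition cond_measure ::
  "'w measure \<Rightarrow> (nat \<Rightarrow> 'w \<Rightarrow> nat) \<Rightarrow> (nat \<Rightarrow> 'w \<Rightarrow> nat) \<Rightarrow> nat set \<Rightarrow> nat \<Rightarrow> type_config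
    \<Rightarrow> 'w measure" where
  "cond_measure M s t Q d c = uniform_measure M {\<omega> \<in> space M. config s t Q d \<omega> = c}"

text \<open>
  In \<open>edge_prob\<close> the edge \<open>i \<sim> j\<close> is conditioned on all types, as in a stochastic blockmodel: given
  all types its probability depends on \<open>s i\<close> and \<open>t j\<close> only. Conditioning on \<open>s i = k\<close> and
  \<open>t j = l\<close> alone would not determine the law of the network.
\<close>

locale bipartite_blockmodel = prob_space M
  for M :: "'w measure" +
  fixes q d K L :: nat
    and w v :: "nat \<Rightarrow> real"
    and p :: "nat \<Rightarrow> nat \<Rightarrow> real"
    and s t :: "nat \<Rightarrow> 'w \<Rightarrow> nat"
    and E :: "nat \<Rightarrow> nat \<Rightarrow> 'w \<Rightarrow> bool"
  assumes w_sum: "(\<Sum>k=1..K. w k) = 1"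
    and v_sum: "(\<Sum>l=1..L. v l) = 1"
    and p_range: "\<And>k l. k \<in> {1..K} \<Longrightarrow> l \<in> {1..L} \<Longrightarrow> 0 \<le> p k l \<and> p k l \<le> 1"
    and types_indep:
      "indep_vars (case_sum (\<lambda>_. count_space {1..K}) (\<lambda>_. count_space {1..L}))
         (case_sum s t) ({1..q} <+> {1..d})"
    and s_dist: "\<And>i k. i \<in> {1..q} \<Longrightarrow> k \<in> {1..K} \<Longrightarrow> \<P>(\<omega> in M. s i \<omega> = k) = w k"
    and t_dist: "\<And>j l. j \<in> {1..d} \<Longrightarrow> l \<in> {1..L} \<Longrightarrow> \<P>(\<omega> in M. t j \<omega> = l) = v l"
    and edge_measurable:
      "\<And>i j. i \<in> {1..q} \<Longrightarrow> j \<in> {1..d} \<Longrightarrow> random_variable (count_space UNIV) (E i j)"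
    and edge_indep:
      "\<And>a. a \<in> realisations M s t K L {1..q} d \<Longrightarrow>
         prob_space.indep_vars (cond_measure M s t {1..q} d a)
           (\<lambda>_. count_space UNIV) (\<lambda>(i, j). E i j) ({1..q} \<times> {1..d})"
    and edge_prob:
      "\<And>a i j. a \<in> realisations M s t K L {1..q} d \<Longrightarrow> i \<in> {1..q} \<Longrightarrow> j \<in> {1..d} \<Longrightarrow>
         \<P>(\<omega> in M. E i j \<omega> \<bar> config s t {1..q} d \<omega> = a) = p (fst a i) (snd a j)"

text \<open>The indicator \<open>I\<^sub>j\<close> of \<open>Q \<sim> j\<close>.\<close>

definition hit :: "(nat \<Rightarrow> nat \<Rightarrow> 'w \<Rightarrow> bool) \<Rightarrow> nat set \<Rightarrow> nat \<Rightarrow> 'w \<Rightarrow> real" where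
  "hit E Q j \<omega> = (MAX i\<in>Q. of_bool (E i j \<omega>))"

definition xi :: "real \<Rightarrow> (nat \<Rightarrow> real) \<Rightarrow> (nat \<Rightarrow> real) \<Rightarrow> nat \<Rightarrow> real" where
  "xi lam prem mu j = prem j / (lam * mu j)"

text \<open>The network Pollaczek--Khintchine variable; the convention \<open>0/0 = 0\<close> is that of HOL.\<close>

definition PK ::
  "real \<Rightarrow> (nat \<Rightarrow> real) \<Rightarrow> (nat \<Rightarrow> real) \<Rightarrow> nat \<Rightarrow> (nat \<Rightarrow> nat \<Rightarrow> 'w \<Rightarrow> bool) \<Rightarrow> nat set
    \<Rightarrow> 'w \<Rightarrow> real" where
  "PK lam prem mu d E Q \<omega> =
    lam * ((\<Sum>j=1..d. hit E Q j \<omega>) / (\<Sum>j=1..d. hit E Q j \<omega> * (prem j / mu j)))"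

definition hit_prob ::
  "'w measure \<Rightarrow> (nat \<Rightarrow> 'w \<Rightarrow> nat) \<Rightarrow> (nat \<Rightarrow> 'w \<Rightarrow> nat) \<Rightarrow> (nat \<Rightarrow> nat \<Rightarrow> 'w \<Rightarrow> bool) \<Rightarrow> nat
    \<Rightarrow> nat set \<Rightarrow> nat \<Rightarrow> type_config \<Rightarrow> real" where
  "hit_prob M s t E d Q j c = \<P>(\<omega> in M. hit E Q j \<omega> = 1 \<bar> config s t Q d \<omega> = c)"

text \<open>For the next three definitions, \<open>x\<close> stands for \<open>j \<mapsto> \<xi>\<^sub>j\<close> and \<open>pr\<close> for \<open>j \<mapsto> p\<^sub>j(c)\<close>.\<close>

definition mean_of :: "(nat \<Rightarrow> real) \<Rightarrow> nat \<Rightarrow> (nat \<Rightarrow> real) \<Rightarrow> real" where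
  "mean_of x d pr = (\<Sum>j=1..d. (x j - 1) * pr j)"

definition var_of :: "(nat \<Rightarrow> real) \<Rightarrow> nat \<Rightarrow> (nat \<Rightarrow> real) \<Rightarrow> real" where
  "var_of x d pr = (\<Sum>j=1..d. (x j - 1)\<^sup>2 * pr j * (1 - pr j))"

definition Z_of ::
  "(nat \<Rightarrow> real) \<Rightarrow> nat \<Rightarrow> (nat \<Rightarrow> real) \<Rightarrow> (nat \<Rightarrow> nat \<Rightarrow> 'w \<Rightarrow> bool) \<Rightarrow> nat set \<Rightarrow> nat \<Rightarrow> 'w
    \<Rightarrow> real" where
  "Z_of x d pr E Q j \<omega> = 1 / sqrt (var_of x d pr) * (x j - 1) * (hit E Q j \<omega> - pr j)"

text \<open>
  \<open>edge_prob_pair\<close> and \<open>hit_prob_eq\<close> check the conventions above: the model implies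
  \<open>\<P>(i \<sim> j | s i = k, t j = l) = p k l\<close>, and the conditional probability \<open>p\<^sub>j(c)\<close> is
  \<open>1 - (\<Prod>i\<in>Q. 1 - p (s i) (t j))\<close>. By \<open>sum_config_prob\<close> the realisations exhaust \<open>C\<^sup>Q\<close>.
\<close>

context bipartite_blockmodel
begin

lemma s_measurable: "i \<in> {1..q} \<Longrightarrow> random_variable (count_space {1..K}) (s i)"
  using types_indep unfolding indep_vars_def by force

lemma t_measurable: "j \<in> {1..d} \<Longrightarrow> random_variable (count_space {1..L}) (t j)"
  using types_indep unfolding indep_vars_def by force

lemma s_event: "i \<in> {1..q} \<Longrightarrow> {\<omega> \<in> space M. s i \<omega> = k} \<in> events"
proof -
  assume i: "i \<in> {1..q}"
  have "{\<omega> \<in> space M. s i \<omega> = k} = s i -` ({k} \<inter> {1..K}) \<inter> space M"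
    using measurable_space[OF s_measurable[OF i]] by auto
  then show ?thesis
    using measurable_sets[OF s_measurable[OF i], of "{k} \<inter> {1..K}"] by simp
qed

lemma t_event: "j \<in> {1..d} \<Longrightarrow> {\<omega> \<in> space M. t j \<omega> = l} \<in> events"
proof -
  assume j: "j \<in> {1..d}"
  have "{\<omega> \<in> space M. t j \<omega> = l} = t j -` ({l} \<inter> {1..L}) \<inter> space M"
    using measurable_space[OF t_measurable[OF j]] by auto
  then show ?thesis
    using measurable_sets[OF t_measurable[OF j], of "{l} \<inter> {1..L}"] by simp
qed

lemma edge_event: "i \<in> {1..q} \<Longrightarrow> j \<in> {1..d} \<Longrightarrow> {\<omega> \<in> space M. E i j \<omega>} \<in> events"
proof -
  assume ij: "i \<in> {1..q}" "j \<in> {1..d}"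
  have "{\<omega> \<in> space M. E i j \<omega>} = E i j -` {True} \<inter> space M" by auto
  then show ?thesis
    using measurable_sets[OF edge_measurable[OF ij], of "{True}"] by simp
qed

lemma config_range:
  assumes "Q \<subseteq> {1..q}" "\<omega> \<in> space M"
  shows "config s t Q d \<omega> \<in> (Q \<rightarrow>\<^sub>E {1..K}) \<times> ({1..d} \<rightarrow>\<^sub>E {1..L})"
proof -
  have "s i \<omega> \<in> {1..K}" if "i \<in> Q" for i
    using measurable_space[OF s_measurable assms(2)] that assms(1) by (simp add: subset_iff)
  moreover have "t j \<omega> \<in> {1..L}" if "j \<in> {1..d}" for j
    using measurable_space[OF t_measurable assms(2)] that by simp
  ultimately show ?thesis
    by (auto simp: config_def simp del: atLeastAtMost_iff)
qed

lemma finite_configs: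
  assumes "Q \<subseteq> {1..q}"
  shows "finite ((Q \<rightarrow>\<^sub>E {1..K}) \<times> ({1..d} \<rightarrow>\<^sub>E {1..L}))"
  using assms by (intro finite_cartesian_product finite_PiE) (auto intro: finite_subset)

lemma config_event:
  assumes "Q \<subseteq> {1..q}"
  shows "{\<omega> \<in> space M. config s t Q d \<omega> = c} \<in> events"
proof (cases "c \<in> (Q \<rightarrow>\<^sub>E {1..K}) \<times> ({1..d} \<rightarrow>\<^sub>E {1..L})")
  case True
  have fin: "finite Q" using assms finite_subset by blast
  obtain a b where c: "c = (a, b)" "a \<in> Q \<rightarrow>\<^sub>E {1..K}" "b \<in> {1..d} \<rightarrow>\<^sub>E {1..L}"
    using True by auto
  have 1: "restrict (\<lambda>i. s i \<omega>) Q = a \<longleftrightarrow> (\<forall>i\<in>Q. s i \<omega> = a i)" for \<omega>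
    using c(2) by (metis PiE_restrict restrict_apply' restrict_ext)
  have 2: "restrict (\<lambda>j. t j \<omega>) {1..d} = b \<longleftrightarrow> (\<forall>j\<in>{1..d}. t j \<omega> = b j)" for \<omega>
    using c(3) by (metis PiE_restrict restrict_apply' restrict_ext)
  have "{\<omega> \<in> space M. config s t Q d \<omega> = c} =
      {\<omega> \<in> space M. (\<forall>i\<in>Q. s i \<omega> = a i) \<and> (\<forall>j\<in>{1..d}. t j \<omega> = b j)}"
    unfolding config_def c(1) prod.inject 1 2 ..
  also have "\<dots> \<in> events"
    using assms
    by (intro sets.sets_Collect_conj sets.sets_Collect_finite_All s_event t_event fin) auto
  finally show ?thesis .
next
  case False
  then have "{\<omega> \<in> space M. config s t Q d \<omega> = c} = {}"
    using config_range[OF assms] by blast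
  then show ?thesis by (metis sets.empty_sets)
qed

lemma prob_space_cond_measure:
  assumes "Q \<subseteq> {1..q}" "c \<in> realisations M s t K L Q d"
  shows "prob_space (cond_measure M s t Q d c)"
  unfolding cond_measure_def
  using assms(2)
  by (intro prob_space_uniform_measure)
    (auto simp: realisations_def config_prob_def emeasure_eq_measure)

lemma sum_config_prob:
  assumes "Q \<subseteq> {1..q}"
  shows "(\<Sum>c\<in>realisations M s t K L Q d. config_prob M s t Q d c) = 1"
proof -
  let ?F = "(Q \<rightarrow>\<^sub>E {1..K}) \<times> ({1..d} \<rightarrow>\<^sub>E {1..L})"
  have "(\<Sum>c\<in>realisations M s t K L Q d. config_prob M s t Q d c) =
      (\<Sum>c\<in>?F. config_prob M s t Q d c)"
    by (rule sum.mono_neutral_left[OF finite_configs[OF assms]])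
      (auto simp: realisations_def config_prob_def measure_nonneg
        intro: antisym[OF _ measure_nonneg] simp: not_less)
  also have "\<dots> = prob (\<Union>c\<in>?F. {\<omega> \<in> space M. config s t Q d \<omega> = c})"
    unfolding config_prob_def
    using finite_configs[OF assms] config_event[OF assms]
    by (intro finite_measure_finite_Union[symmetric]) (auto simp: disjoint_family_on_def)
  also have "(\<Union>c\<in>?F. {\<omega> \<in> space M. config s t Q d \<omega> = c}) = space M"
    using config_range[OF assms] by blast
  finally show ?thesis by (simp add: prob_space)
qed

lemma total_probability:
  assumes A: "{\<omega> \<in> space M. A \<omega>} \<in> events"
    and r: "\<And>a. a \<in> realisations M s t K L {1..q} d \<Longrightarrow> g a \<Longrightarrow>
        \<P>(\<omega> in M. A \<omega> \<bar> config s t {1..q} d \<omega> = a) = r"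
    and pos: "\<P>(\<omega> in M. g (config s t {1..q} d \<omega>)) > 0"
  shows "\<P>(\<omega> in M. A \<omega> \<bar> g (config s t {1..q} d \<omega>)) = r"
proof -
  let ?C = "config s t {1..q} d"
  let ?F = "{a \<in> ({1..q} \<rightarrow>\<^sub>E {1..K}) \<times> ({1..d} \<rightarrow>\<^sub>E {1..L}). g a}"
  have fin: "finite ?F" using finite_configs[of "{1..q}"] by simp
  have split: "\<P>(\<omega> in M. B \<omega> \<and> g (?C \<omega>)) = (\<Sum>a\<in>?F. \<P>(\<omega> in M. B \<omega> \<and> ?C \<omega> = a))"
    if B: "{\<omega> \<in> space M. B \<omega>} \<in> events" for B
  proof -
    have "{\<omega> \<in> space M. B \<omega> \<and> g (?C \<omega>)} = (\<Union>a\<in>?F. {\<omega> \<in> space M. B \<omega> \<and> ?C \<omega> = a})"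
      using config_range[of "{1..q}"] by auto
    moreover have "prob \<dots> = (\<Sum>a\<in>?F. \<P>(\<omega> in M. B \<omega> \<and> ?C \<omega> = a))"
      using sets.sets_Collect_conj[OF config_event[of "{1..q}"] B]
      by (intro finite_measure_finite_Union fin) (auto simp: disjoint_family_on_def)
    ultimately show ?thesis by simp
  qed
  have "\<P>(\<omega> in M. A \<omega> \<and> ?C \<omega> = a) = r * \<P>(\<omega> in M. ?C \<omega> = a)" if a: "a \<in> ?F" for a
  proof (cases "\<P>(\<omega> in M. ?C \<omega> = a) = 0")
    case True
    have "\<P>(\<omega> in M. A \<omega> \<and> ?C \<omega> = a) \<le> \<P>(\<omega> in M. ?C \<omega> = a)"
      by (rule finite_measure_mono) (use config_event[of "{1..q}" a] in auto)
    then show ?thesis using True by (simp add: measure_le_0_iff)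
  next
    case False
    then have "a \<in> realisations M s t K L {1..q} d"
      using a by (auto simp: realisations_def config_prob_def zero_less_measure_iff)
    from r[OF this] a False show ?thesis by (simp add: cond_prob_def field_simps)
  qed
  then have "\<P>(\<omega> in M. A \<omega> \<and> g (?C \<omega>)) = r * \<P>(\<omega> in M. g (?C \<omega>))"
    using split[OF A] split[of "\<lambda>_. True"] by (simp add: sum_distrib_left)
  with pos show ?thesis by (simp add: cond_prob_def)
qed

lemma edge_prob_pair:
  assumes i: "i \<in> {1..q}" and j: "j \<in> {1..d}"
    and pos: "\<P>(\<omega> in M. s i \<omega> = k \<and> t j \<omega> = l) > 0"
  shows "\<P>(\<omega> in M. E i j \<omega> \<bar> s i \<omega> = k \<and> t j \<omega> = l) = p k l"
proof -
  let ?g = "\<lambda>a :: type_config. fst a i = k \<and> snd a j = l"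
  have g: "?g (config s t {1..q} d \<omega>) \<longleftrightarrow> s i \<omega> = k \<and> t j \<omega> = l" for \<omega>
    using i j by (simp add: config_def)
  show ?thesis
    using total_probability[OF edge_event[OF i j], of ?g "p k l"] edge_prob[OF _ i j] pos
    unfolding g by blast
qed

lemma hit_eq_1_iff:
  assumes "finite Q" "Q \<noteq> {}"
  shows "hit E Q j \<omega> = 1 \<longleftrightarrow> (\<exists>i\<in>Q. E i j \<omega>)"
proof
  assume "hit E Q j \<omega> = 1"
  then have "1 \<in> (\<lambda>i. of_bool (E i j \<omega>) :: real) ` Q"
    unfolding hit_def using Max_in[of "(\<lambda>i. of_bool (E i j \<omega>) :: real) ` Q"] assms by auto
  then show "\<exists>i\<in>Q. E i j \<omega>" by (auto split: if_splits simp: of_bool_def)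
next
  assume "\<exists>i\<in>Q. E i j \<omega>"
  then show "hit E Q j \<omega> = 1"
    unfolding hit_def using assms by (intro Max_eqI) (auto simp: image_iff)
qed

lemma hit_prob_eq:
  assumes Q: "Q \<subseteq> {1..q}" "Q \<noteq> {}" and j: "j \<in> {1..d}"
    and c: "c \<in> realisations M s t K L Q d"
  shows "hit_prob M s t E d Q j c = 1 - (\<Prod>i\<in>Q. 1 - p (fst c i) (snd c j))"
proof -
  let ?C = "config s t {1..q} d"
  let ?g = "\<lambda>a :: type_config. (restrict (fst a) Q, snd a) = c"
  have fin: "finite Q" using Q finite_subset by blast
  have g: "?g (?C \<omega>) \<longleftrightarrow> config s t Q d \<omega> = c" for \<omega>
  proof -
    have "{1..q} \<inter> Q = Q" using Q by auto
    then show ?thesis by (simp add: config_def restrict_restrict)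
  qed
  have hit: "{\<omega> \<in> space M. hit E Q j \<omega> = 1} = {\<omega> \<in> space M. \<exists>i\<in>Q. E i j \<omega>}"
    using hit_eq_1_iff[OF fin Q(2)] by simp
  have ev: "{\<omega> \<in> space M. hit E Q j \<omega> = 1} \<in> events"
    unfolding hit using Q j by (intro sets.sets_Collect_finite_Ex edge_event fin) auto
  have "\<P>(\<omega> in M. hit E Q j \<omega> = 1 \<bar> ?C \<omega> = a) = 1 - (\<Prod>i\<in>Q. 1 - p (fst c i) (snd c j))"
    if a: "a \<in> realisations M s t K L {1..q} d" and ga: "?g a" for a
  proof -
    let ?U = "cond_measure M s t {1..q} d a"
    interpret U: prob_space ?U using prob_space_cond_measure[OF _ a] by simp
    have spU: "space ?U = space M" and seU: "sets ?U = events"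
      by (simp_all add: cond_measure_def)
    have condU: "U.prob {\<omega> \<in> space M. A \<omega>} = \<P>(\<omega> in M. A \<omega> \<bar> ?C \<omega> = a)"
      if "{\<omega> \<in> space M. A \<omega>} \<in> events" for A
      using measure_uniform_measure_eq_cond_prob[of A "\<lambda>\<omega>. ?C \<omega> = a"] that config_event[of "{1..q}" a]
      by (simp add: cond_measure_def pred_def)
    have no_edge: "U.prob {\<omega> \<in> space M. \<not> E i j \<omega>} = 1 - p (fst c i) (snd c j)" if i: "i \<in> Q" for i
    proof -
      have iq: "i \<in> {1..q}" using i Q by auto
      have "fst c i = fst a i" "snd c j = snd a j" using ga i by auto
      then have "U.prob {\<omega> \<in> space M. E i j \<omega>} = p (fst c i) (snd c j)"
        using condU[OF edge_event[OF iq j]] edge_prob[OF a iq j] by simp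
      then show ?thesis
        using U.prob_neg[of "\<lambda>\<omega>. E i j \<omega>"] edge_event[OF iq j]
        unfolding spU seU by simp
    qed
    have sub: "(\<lambda>i. (i, j)) ` Q \<subseteq> {1..q} \<times> {1..d}" using Q j by auto
    have "U.prob (\<Inter>e\<in>(\<lambda>i. (i, j)) ` Q. (case e of (i, j) \<Rightarrow> E i j) -` {False} \<inter> space ?U) =
        (\<Prod>e\<in>(\<lambda>i. (i, j)) ` Q. U.prob ((case e of (i, j) \<Rightarrow> E i j) -` {False} \<inter> space ?U))"
      using U.indep_varsD[OF edge_indep[OF a], of "(\<lambda>i. (i, j)) ` Q" "\<lambda>_. {False}"] fin Q(2) sub
      by simp
    moreover have "(\<Inter>e\<in>(\<lambda>i. (i, j)) ` Q. (case e of (i, j) \<Rightarrow> E i j) -` {False} \<inter> space ?U) =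
        {\<omega> \<in> space M. \<not> (\<exists>i\<in>Q. E i j \<omega>)}"
      using Q(2) unfolding spU by auto
    moreover have "(\<Prod>e\<in>(\<lambda>i. (i, j)) ` Q. U.prob ((case e of (i, j) \<Rightarrow> E i j) -` {False} \<inter> space ?U)) =
        (\<Prod>i\<in>Q. U.prob {\<omega> \<in> space M. \<not> E i j \<omega>})"
    proof -
      have "(E i j) -` {False} \<inter> space ?U = {\<omega> \<in> space M. \<not> E i j \<omega>}" for i
        unfolding spU by auto
      then show ?thesis by (subst prod.reindex) (auto simp: inj_on_def)
    qed
    ultimately have "U.prob {\<omega> \<in> space M. \<not> (\<exists>i\<in>Q. E i j \<omega>)} =
        (\<Prod>i\<in>Q. 1 - p (fst c i) (snd c j))"
      using no_edge by simp
    then have "U.prob {\<omega> \<in> space M. hit E Q j \<omega> = 1} = 1 - (\<Prod>i\<in>Q. 1 - p (fst c i) (snd c j))"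
      using U.prob_neg[of "\<lambda>\<omega>. \<exists>i\<in>Q. E i j \<omega>"] ev unfolding hit spU seU by simp
    then show ?thesis using condU[OF ev] by simp
  qed
  moreover have "\<P>(\<omega> in M. ?g (?C \<omega>)) > 0"
    using c unfolding g by (simp add: realisations_def config_prob_def)
  ultimately show ?thesis
    using total_probability[OF ev, of ?g] unfolding g hit_prob_def by blast
qed

end

end

theory Submission
  imports Defs
begin

text \<open>
  Conditionally on the types of the agents in \<open>Q\<close> and of all objects, the indicators \<open>I\<^sub>j\<close> are
  independent Bernoulli variables: given all types the edges are independent, and the conditional
  probability that a set of objects stays unhit is a product that depends on the types in the
  configuration only, so averaging over the remaining types changes nothing
  (\<open>cond_prob_no_hits\<close>). With \<open>S = \<Sum>j. (\<xi>\<^sub>j - 1) I\<^sub>j\<close>, the event \<open>P\<^sup>Q < 1\<close> lies between \<open>S > 0\<close> and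
  \<open>S \<ge> 0\<close>; it differs from \<open>S > 0\<close> exactly when no object is hit, because of \<open>0/0 = 0\<close>. So it
  suffices to have, for every configuration, a Berry--Esseen bound for \<open>S\<close> and for \<open>- S\<close>, and to
  average over the configurations.

  The Berry--Esseen bound (\<open>berry_esseen\<close>) is proved by Stein's method. Let
  \<open>W = \<Sum>j. x\<^sub>j (Y\<^sub>j - p\<^sub>j)\<close> have variance 1, where the \<open>Y\<^sub>j\<close> are independent Bernoulli variables,
  put \<open>v\<^sub>j = p\<^sub>j (1 - p\<^sub>j)\<close> and \<open>\<beta> = \<Sum>j. v\<^sub>j \<bar>x\<^sub>j\<bar>\<^sup>3\<close>, and write \<open>W\<^sub>j\<^sub>,\<^sub>b\<close> for \<open>W\<close> with \<open>Y\<^sub>j\<close> replaced by \<open>b\<close>.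
  Independence gives the exact identity (\<open>stein_identity\<close>)
  \<open>E W G(W) = \<Sum>j. v\<^sub>j x\<^sub>j E (G(W\<^sub>j\<^sub>,\<^sub>1) - G(W\<^sub>j\<^sub>,\<^sub>0))\<close>,
  in which the increment of \<open>G\<close> runs over an interval of length \<open>\<bar>x\<^sub>j\<bar>\<close> that has \<open>W\<close> as one of its two
  end points. This last point is special to two-valued summands and makes two things easy.

  First, a concentration inequality \<open>P(a \<le> W \<le> b) \<le> b - a + \<beta>\<close>: apply the identity to the function
  that has slope 1 on the \<open>\<beta>/2\<close>-neighbourhood of \<open>[a, b]\<close> and is constant outside. When \<open>W\<close> lies
  in \<open>[a, b]\<close>, each increment is at least \<open>min (\<beta>/2) \<bar>x\<^sub>j\<bar>\<close>, a deterministic quantity that can be taken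
  out of the expectation.

  Second, the comparison with the normal law: for the solution \<open>f\<close> of Stein's equation
  \<open>f' w - w f w = 1{w \<le> z} - \<Phi> z\<close>, the error \<open>P(W \<le> z) - \<Phi> z\<close> is \<open>E f' W - E W f W\<close>, where \<open>f' z\<close>
  at the kink \<open>z\<close> of \<open>f\<close> is defined by the equation. By the
  identity this is a weighted average of expected differences between \<open>f' W\<close> and slopes of \<open>f\<close> over intervals that
  start or end in \<open>W\<close>. The part \<open>w f w\<close> of \<open>f'\<close> varies by at most \<open>(\<bar>W\<bar> + \<surd>(2\<pi>)/2) \<bar>x\<^sub>j\<bar>\<close> over such an interval, and
  the jump of the indicator matters only if \<open>W\<close> is within \<open>\<bar>x\<^sub>j\<bar>\<close> of \<open>z\<close>, on one side of \<open>z\<close> for each of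
  the two estimates; the concentration inequality bounds that probability by \<open>\<bar>x\<^sub>j\<bar> + \<beta>\<close>. The
  contributions add up to \<open>(3 + \<surd>(2\<pi>)/2) \<beta> \<le> 4.7 \<beta>\<close>, and \<open>\<beta>\<close> is at most twice the sum of the
  absolute third moments because \<open>p\<^sup>2 + (1 - p)\<^sup>2 \<ge> 1/2\<close>.
\<close>

section \<open>The standard normal distribution function\<close>

definition Phi :: "real \<Rightarrow> real" where
  "Phi = cdf std_normal_distribution"

lemma Phi_nonneg: "0 \<le> Phi z" and Phi_le_1: "Phi z \<le> 1" and Phi_mono: "x \<le> y \<Longrightarrow> Phi x \<le> Phi y"
  and Phi_at_top: "(Phi \<longlongrightarrow> 1) at_top"
proof -
  interpret real_distribution std_normal_distribution by (rule real_dist_normal_dist)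
  show "0 \<le> Phi z" "Phi z \<le> 1" "x \<le> y \<Longrightarrow> Phi x \<le> Phi y" "(Phi \<longlongrightarrow> 1) at_top"
    unfolding Phi_def
    by (rule cdf_nonneg cdf_bounded_prob cdf_nondecreasing cdf_lim_at_top_prob | assumption)+
qed

lemma continuous_on_std_normal_density: "continuous_on A std_normal_density"
  unfolding std_normal_density_def by (intro continuous_intros) auto

lemma DERIV_Phi: "(Phi has_real_derivative std_normal_density z) (at z)"
proof -
  interpret real_distribution std_normal_distribution by (rule real_dist_normal_dist)
  let ?a = "z - 1" and ?b = "z + 1"
  have eq: "Phi u = Phi ?a + integral {?a..u} std_normal_density" if u: "?a \<le> u" for u
  proof (cases "?a = u")
    case False
    with u have "Phi u - Phi ?a = measure std_normal_distribution {?a<..u}"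
      unfolding Phi_def by (intro cdf_diff_eq) auto
    also have "\<dots> = (LINT x|std_normal_distribution. indicator {?a<..u} x)"
      by simp
    also have "\<dots> = (LBINT x:{?a<..u}. std_normal_density x)"
      unfolding set_lebesgue_integral_def
      by (subst integral_density) (auto simp: mult.commute)
    also have "\<dots> = (LBINT x:{?a..u}. std_normal_density x)"
      unfolding set_lebesgue_integral_def
      using AE_lborel_singleton[of ?a]
      by (intro integral_cong_AE) (auto simp: indicator_def)
    also have "\<dots> = integral {?a..u} std_normal_density"
      by (intro set_borel_integral_eq_integral borel_integrable_atLeastAtMost'
           continuous_on_std_normal_density)
    finally show ?thesis by simp
  qed simp
  have "((\<lambda>u. Phi ?a + integral {?a..u} std_normal_density) has_real_derivative std_normal_density z)
      (at z within {?a..?b})"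
    by (auto intro!: derivative_eq_intros integral_has_real_derivative continuous_on_std_normal_density)
  then have "((\<lambda>u. Phi ?a + integral {?a..u} std_normal_density) has_real_derivative std_normal_density z)
      (at z)"
    by (subst (asm) at_within_interior) (auto simp: interior_atLeastAtMost_real)
  then show ?thesis
    by (rule has_field_derivative_transform_within_open[where S="{?a<..<?b}"])
      (auto intro!: eq[symmetric])
qed

lemma continuous_on_Phi: "continuous_on A Phi"
  using DERIV_Phi by (intro continuous_at_imp_continuous_on) (auto dest: DERIV_isCont)

lemma std_normal_density_even: "std_normal_density (- z) = std_normal_density z"
  by (simp add: std_normal_density_def)

lemma Phi_uminus: "Phi (- z) = 1 - Phi z"
proof -
  let ?D = "std_normal_distribution"
  interpret D: real_distribution ?D by (rule real_dist_normal_dist)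
  have reflect: "distr ?D lborel uminus = ?D"
  proof -
    have "density (distr lborel lborel uminus) std_normal_density = distr (density lborel (\<lambda>x. std_normal_density (- x))) lborel uminus"
      by (rule density_distr) auto
    moreover have "distr lborel lborel uminus = (lborel :: real measure)"
      using lborel_distr_uminus by (metis distr_cong sets_lborel)
    ultimately show ?thesis by (simp add: std_normal_density_even)
  qed
  have "measure ?D {- z} = (LINT x|?D. indicator {- z} x)" by simp
  also have "\<dots> = 0"
    using AE_lborel_singleton[of "- z"]
    by (subst integral_density) (auto intro!: integral_eq_zero_AE simp: indicator_def)
  finally have pt: "measure ?D {- z} = 0" .
  have "Phi z = measure (distr ?D lborel uminus) {..z}"
    by (simp add: Phi_def cdf_def reflect)
  also have "\<dots> = measure ?D {- z..}"
    by (subst measure_distr) (auto intro!: arg_cong[where f="measure ?D"])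
  also have "{- z..} = {- z} \<union> {- z<..}" by auto
  also have "measure ?D \<dots> = measure ?D {- z<..}"
    using pt by (subst D.finite_measure_Union) auto
  also have "{- z<..} = space ?D - {..- z}" by auto
  also have "measure ?D \<dots> = 1 - Phi (- z)"
    by (subst D.prob_compl) (auto simp: Phi_def cdf_def)
  finally show ?thesis by simp
qed

lemma Phi_0: "Phi 0 = 1/2"
  using Phi_uminus[of 0] by simp

lemma DERIV_std_normal_density:
  "(std_normal_density has_real_derivative - x * std_normal_density x) (at x)"
  unfolding std_normal_density_def by (auto intro!: derivative_eq_intros simp: field_simps)

lemma std_normal_density_pos: "std_normal_density x > 0"
  by (simp add: normal_density_pos)

lemma std_normal_density_neq_0: "std_normal_density x \<noteq> 0"
  using std_normal_density_pos[of x] by simp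

lemma std_normal_density_at_top: "(std_normal_density \<longlongrightarrow> 0) at_top"
proof -
  have "filterlim (\<lambda>x::real. x\<^sup>2 * (1/2)) at_top at_top"
    by (rule filterlim_at_top_mult_tendsto_pos[OF tendsto_const])
       (auto intro: filterlim_pow_at_top filterlim_ident)
  then have "filterlim (\<lambda>x::real. - (x\<^sup>2 * (1/2))) at_bot at_top"
    by (simp add: filterlim_uminus_at_bot)
  from filterlim_compose[OF exp_at_bot this]
  have "((\<lambda>x::real. (1 / sqrt (2 * pi)) * exp (- (x\<^sup>2 * (1/2)))) \<longlongrightarrow> 0) at_top"
    by (rule tendsto_mult_right_zero)
  then show ?thesis unfolding std_normal_density_def by simp
qed

text \<open>
  The difference \<open>std_normal_density y / y - (1 - Phi y)\<close> has derivative
  \<open>- std_normal_density y / y\<^sup>2 < 0\<close> and tends to \<open>0\<close> at infinity, so it is positive.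
\<close>

lemma Mills_ratio_le:
  assumes "x > 0"
  shows "x * (1 - Phi x) \<le> std_normal_density x"
proof -
  have "0 < std_normal_density x / x - (1 - Phi x)"
  proof (rule DERIV_neg_imp_decreasing_at_top[where f = "\<lambda>x. std_normal_density x / x - (1 - Phi x)"])
    fix y assume "x \<le> y"
    then have y: "y > 0" using assms by simp
    have "((\<lambda>x. std_normal_density x / x - (1 - Phi x)) has_real_derivative - std_normal_density y / y\<^sup>2) (at y)"
      using y by (auto intro!: derivative_eq_intros DERIV_std_normal_density DERIV_Phi simp: field_simps power2_eq_square)
    moreover have "- std_normal_density y / y\<^sup>2 < 0" using y std_normal_density_pos[of y] by simp
    ultimately show "\<exists>d. ((\<lambda>x. std_normal_density x / x - (1 - Phi x)) has_real_derivative d) (at y) \<and> d < 0"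
      by blast
  next
    have "((\<lambda>x. std_normal_density x / x - (1 - Phi x)) \<longlongrightarrow> 0 - (1 - 1)) at_top"
      by (intro tendsto_diff tendsto_const Phi_at_top tendsto_divide_0[OF std_normal_density_at_top] filterlim_at_top_imp_at_infinity filterlim_ident)
    then show "((\<lambda>x. std_normal_density x / x - (1 - Phi x)) \<longlongrightarrow> 0) at_top" by simp
  qed
  then show ?thesis using assms by (simp add: field_simps)
qed


lemma Mills_ratio_le_1: "0 \<le> x \<Longrightarrow> x * ((1 - Phi x) / std_normal_density x) \<le> 1"
  using Mills_ratio_le[of x] std_normal_density_pos[of x] by (cases "x = 0") (auto simp: field_simps)

text \<open>
  By the previous bound, the Mills ratio \<open>g\<close> has derivative \<open>y * g y - 1 \<le> 0\<close>, so on the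
  half-line it is largest at \<open>0\<close>.
\<close>

lemma Mills_ratio_le_at_0:
  assumes "0 \<le> x"
  shows "(1 - Phi x) / std_normal_density x \<le> sqrt (2 * pi) / 2"
proof -
  have "(1 - Phi x) / std_normal_density x \<le> (1 - Phi 0) / std_normal_density 0"
  proof (rule DERIV_nonpos_imp_decreasing_open[OF assms, where f = "\<lambda>x. (1 - Phi x) / std_normal_density x"])
    fix y :: real assume "0 < y"
    have "((\<lambda>x. (1 - Phi x) / std_normal_density x) has_real_derivative
        y * ((1 - Phi y) / std_normal_density y) - 1) (at y)"
      using std_normal_density_pos[of y]
      by (auto intro!: derivative_eq_intros DERIV_Phi DERIV_std_normal_density simp: field_simps)
    then show "\<exists>d. ((\<lambda>x. (1 - Phi x) / std_normal_density x) has_real_derivative d) (at y) \<and> d \<le> 0"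
      using Mills_ratio_le_1[of y] \<open>0 < y\<close> by fastforce
  next
    show "continuous_on {0..x} (\<lambda>x. (1 - Phi x) / std_normal_density x)"
      by (intro continuous_intros continuous_on_Phi continuous_on_std_normal_density)
        (simp add: std_normal_density_neq_0)
  qed
  also have "\<dots> = sqrt (2 * pi) / 2"
    by (simp add: Phi_0 std_normal_density_def)
  finally show ?thesis .
qed

lemma (in prob_space) normal_prob_greater_0:
  assumes X: "distributed M lborel X (normal_density \<mu> \<sigma>)" and \<sigma>: "0 < \<sigma>"
  shows "\<P>(\<omega> in M. X \<omega> > 0) = Phi (\<mu> / \<sigma>)"
proof -
  let ?Z = "\<lambda>\<omega>. (X \<omega> - \<mu>) / \<sigma>"
  have Z: "distributed M lborel ?Z std_normal_density"
    using X normal_standard_normal_convert[OF \<sigma>] by simp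
  have m [measurable]: "random_variable borel ?Z"
    using distributed_measurable[OF Z] by simp
  have "Phi (- \<mu> / \<sigma>) = measure (distr M lborel ?Z) {..- \<mu> / \<sigma>}"
    unfolding Phi_def cdf_def distributed_distr_eq_density[OF Z] ..
  also have "\<dots> = \<P>(\<omega> in M. ?Z \<omega> \<le> - \<mu> / \<sigma>)"
    by (subst measure_distr) (auto intro!: arg_cong[where f = prob])
  finally have "1 - Phi (- (\<mu> / \<sigma>)) = 1 - \<P>(\<omega> in M. ?Z \<omega> \<le> - \<mu> / \<sigma>)" by simp
  also have "\<dots> = \<P>(\<omega> in M. \<not> ?Z \<omega> \<le> - \<mu> / \<sigma>)"
    by (rule prob_neg[symmetric]) measurable
  also have "{\<omega> \<in> space M. \<not> ?Z \<omega> \<le> - \<mu> / \<sigma>} = {\<omega> \<in> space M. X \<omega> > 0}"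
    using \<sigma> by (auto simp: field_simps mult_le_0_iff)
  finally show ?thesis by (simp add: Phi_uminus)
qed

section \<open>The Stein equation for half-line indicators\<close>

text \<open>
  The bounded solution of \<open>f' w - w * f w = indicator {..z} w - Phi z\<close>. Writing it with \<open>min\<close> and
  \<open>max\<close> merges the usual two cases \<open>w \<le> z\<close> and \<open>z < w\<close> and makes continuity at \<open>z\<close> evident.
\<close>

definition stein_sol :: "real \<Rightarrow> real \<Rightarrow> real" where
  "stein_sol z w = Phi (min w z) * (1 - Phi (max w z)) / std_normal_density w"

text \<open>
  The right-hand side of Stein's equation solved for \<open>f'\<close>. It is the derivative of \<open>stein_sol z\<close>
  except at \<open>z\<close>, where \<open>stein_sol z\<close> has a kink; there it takes the value of the left derivative.
\<close>

definition stein_deriv :: "real \<Rightarrow> real \<Rightarrow> real" where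
  "stein_deriv z w = w * stein_sol z w + indicator {..z} w - Phi z"

lemma stein_sol_nonneg: "0 \<le> stein_sol z w"
  unfolding stein_sol_def using Phi_nonneg Phi_le_1 std_normal_density_pos[of w]
  by (intro divide_nonneg_pos mult_nonneg_nonneg) auto

text \<open>
  The symmetry that reduces bounds at negative \<open>w\<close> to bounds at positive \<open>w\<close>.
\<close>

lemma stein_sol_reflect: "stein_sol (- z) (- w) = stein_sol z w"
proof -
  have "min (- w) (- z) = - max w z" "max (- w) (- z) = - min w z" by auto
  then show ?thesis by (simp add: stein_sol_def Phi_uminus std_normal_density_even)
qed

lemma continuous_on_stein_sol: "continuous_on A (stein_sol z)"
proof -
  have "continuous_on UNIV (\<lambda>w. Phi (min w z) * (1 - Phi (max w z)) / std_normal_density w)"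
    by (intro continuous_intros continuous_on_compose2[OF continuous_on_Phi[of UNIV]]
        continuous_on_std_normal_density) (auto simp: std_normal_density_neq_0)
  then show ?thesis
    unfolding stein_sol_def[abs_def] by (rule continuous_on_subset) simp
qed

lemma stein_sol_le_Mills_ratio: "stein_sol z w \<le> Phi (min w z) * ((1 - Phi w) / std_normal_density w)"
proof -
  have "Phi (min w z) * (1 - Phi (max w z)) \<le> Phi (min w z) * (1 - Phi w)"
    using Phi_mono[of w "max w z"] Phi_nonneg by (intro mult_left_mono) auto
  then show ?thesis
    unfolding stein_sol_def using std_normal_density_pos[of w] by (simp add: divide_right_mono)
qed

lemma stein_sol_le: "stein_sol z w \<le> sqrt (2 * pi) / 2"
proof -
  have *: "stein_sol z w \<le> sqrt (2 * pi) / 2" if w: "0 \<le> w" for z w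
  proof -
    have "stein_sol z w \<le> Phi (min w z) * ((1 - Phi w) / std_normal_density w)"
      by (rule stein_sol_le_Mills_ratio)
    also have "\<dots> \<le> 1 * ((1 - Phi w) / std_normal_density w)"
      using Phi_le_1 std_normal_density_pos[of w]
      by (intro mult_right_mono) (auto intro!: divide_nonneg_pos)
    also have "\<dots> \<le> sqrt (2 * pi) / 2" using Mills_ratio_le_at_0[OF w] by simp
    finally show ?thesis .
  qed
  show ?thesis using *[of w z] *[of "- w" "- z"] by (cases "0 \<le> w") (auto simp: stein_sol_reflect)
qed

lemma mult_stein_sol_le: "0 \<le> w \<Longrightarrow> w * stein_sol z w \<le> Phi (min w z)"
proof -
  assume w: "0 \<le> w"
  have "w * stein_sol z w \<le> w * (Phi (min w z) * ((1 - Phi w) / std_normal_density w))"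
    using w by (intro mult_left_mono stein_sol_le_Mills_ratio)
  also have "\<dots> = Phi (min w z) * (w * ((1 - Phi w) / std_normal_density w))" by simp
  also have "\<dots> \<le> Phi (min w z)"
    using Mills_ratio_le_1[OF w] Phi_nonneg by (intro mult_left_le) auto
  finally show ?thesis .
qed

text \<open>
  For \<open>w \<ge> 0\<close> the term \<open>w * stein_sol z w\<close> lies between \<open>0\<close> and \<open>Phi (min w z)\<close>; by reflection,
  for \<open>w < 0\<close> it lies between \<open>- (1 - Phi (max w z))\<close> and \<open>0\<close>. In each of the four sign and order
  cases it has the sign opposite to \<open>indicator {..z} w - Phi z\<close>, or is small enough to be added to it.
\<close>

lemma abs_stein_deriv_le_1: "\<bar>stein_deriv z w\<bar> \<le> 1"
proof (cases "0 \<le> w")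
  case True
  have "0 \<le> w * stein_sol z w" using True stein_sol_nonneg by simp
  moreover note mult_stein_sol_le[OF True, of z]
  ultimately show ?thesis
    using Phi_mono[of w z] Phi_le_1[of z] Phi_nonneg[of z]
    by (cases "w \<le> z") (auto simp: stein_deriv_def min_def)
next
  case False
  have "(- w) * stein_sol (- z) (- w) \<le> Phi (min (- w) (- z))"
    using False by (intro mult_stein_sol_le) auto
  also have "min (- w) (- z) = - max w z" by auto
  finally have "- (w * stein_sol z w) \<le> 1 - Phi (max w z)"
    by (simp add: stein_sol_reflect Phi_uminus)
  moreover have "w * stein_sol z w \<le> 0"
    using False stein_sol_nonneg by (simp add: mult_nonpos_nonneg)
  ultimately show ?thesis
    using Phi_mono[of z w] Phi_le_1[of z] Phi_nonneg[of z]
    by (cases "w \<le> z") (auto simp: stein_deriv_def max_def)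
qed

lemma DERIV_stein_sol:
  assumes "w \<noteq> z"
  shows "(stein_sol z has_real_derivative stein_deriv z w) (at w)"
proof (cases "w < z")
  case True
  have "((\<lambda>w. Phi w * (1 - Phi z) / std_normal_density w) has_real_derivative stein_deriv z w) (at w)"
    using True std_normal_density_pos[of w]
    by (auto intro!: derivative_eq_intros DERIV_Phi DERIV_std_normal_density
        simp: stein_deriv_def stein_sol_def field_simps)
  then show ?thesis
    by (rule has_field_derivative_transform_within_open[where S="{..<z}"]) (use True in \<open>auto simp: stein_sol_def\<close>)
next
  case False
  then have zw: "z < w" using assms by simp
  have "((\<lambda>w. Phi z * (1 - Phi w) / std_normal_density w) has_real_derivative stein_deriv z w) (at w)"
    using zw std_normal_density_pos[of w]
    by (auto intro!: derivative_eq_intros DERIV_Phi DERIV_std_normal_density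
        simp: stein_deriv_def stein_sol_def field_simps)
  then show ?thesis
    by (rule has_field_derivative_transform_within_open[where S="{z<..}"]) (use zw in \<open>auto simp: stein_sol_def\<close>)
qed

text \<open>
  A mean value inequality that tolerates one kink: \<open>f t - R * t\<close> is monotone on both sides of
  \<open>z\<close>, hence everywhere by continuity.
\<close>

lemma increment_ge_except_one_point:
  fixes f :: "real \<Rightarrow> real"
  assumes "u \<le> v" and cont: "continuous_on {u..v} f"
    and der: "\<And>t. u < t \<Longrightarrow> t < v \<Longrightarrow> t \<noteq> z \<Longrightarrow> (f has_real_derivative f' t) (at t) \<and> R \<le> f' t"
  shows "R * (v - u) \<le> f v - f u"
proof -
  let ?g = "\<lambda>t. f t - R * t"
  have *: "?g a \<le> ?g b" if ab: "u \<le> a" "a \<le> b" "b \<le> v" and z: "\<And>t. a < t \<Longrightarrow> t < b \<Longrightarrow> t \<noteq> z" for a b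
  proof (rule DERIV_nonneg_imp_increasing_open[OF ab(2), where f = ?g])
    fix t assume t: "a < t" "t < b"
    have "(?g has_real_derivative f' t - R) (at t)"
      using der[of t] t ab z[OF t] by (auto intro!: derivative_eq_intros)
    then show "\<exists>y. (?g has_real_derivative y) (at t) \<and> 0 \<le> y"
      using der[of t] t ab z[OF t] by auto
  next
    show "continuous_on {a..b} ?g"
      using ab by (intro continuous_intros continuous_on_subset[OF cont]) auto
  qed
  have "?g u \<le> ?g v"
  proof (cases "u \<le> z \<and> z \<le> v")
    case True
    then show ?thesis using *[of u z] *[of z v] by force
  next
    case False
    then show ?thesis using *[of u v] \<open>u \<le> v\<close> by force
  qed
  then show ?thesis by (simp add: algebra_simps)
qed

lemma increment_le_except_one_point:
  fixes f :: "real \<Rightarrow> real"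
  assumes "u \<le> v" and cont: "continuous_on {u..v} f"
    and der: "\<And>t. u < t \<Longrightarrow> t < v \<Longrightarrow> t \<noteq> z \<Longrightarrow> (f has_real_derivative f' t) (at t) \<and> f' t \<le> R"
  shows "f v - f u \<le> R * (v - u)"
proof -
  have "(- R) * (v - u) \<le> (- f v) - (- f u)"
    by (rule increment_ge_except_one_point[where f = "\<lambda>t. - f t" and f' = "\<lambda>t. - f' t" and z = z])
      (use assms in \<open>auto intro!: continuous_intros DERIV_minus\<close>)
  then show ?thesis by simp
qed

lemma stein_sol_lipschitz: "\<bar>stein_sol z v - stein_sol z u\<bar> \<le> \<bar>v - u\<bar>"
proof -
  have *: "\<bar>stein_sol z v - stein_sol z u\<bar> \<le> v - u" if "u \<le> v" for u v
  proof -
    have "(- 1) * (v - u) \<le> stein_sol z v - stein_sol z u"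
      using abs_stein_deriv_le_1[of z] DERIV_stein_sol[of _ z]
      by (intro increment_ge_except_one_point[OF that continuous_on_stein_sol, where z = z]) (auto simp: abs_le_iff minus_le_iff)
    moreover have "stein_sol z v - stein_sol z u \<le> 1 * (v - u)"
      using abs_stein_deriv_le_1[of z] DERIV_stein_sol[of _ z]
      by (intro increment_le_except_one_point[OF that continuous_on_stein_sol, where z = z]) (auto simp: abs_le_iff)
    ultimately show ?thesis by simp
  qed
  show ?thesis using *[of u v] *[of v u] by (cases "u \<le> v") auto
qed

text \<open>
  The slope of \<open>stein_sol z\<close> over \<open>[u, v]\<close> is compared with \<open>stein_deriv z w\<close> at a point \<open>w\<close> of the
  interval. Passing from \<open>w\<close> to another point of \<open>[u, v]\<close> can lower the indicator \<open>indicator {..z}\<close>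
  only if \<open>z - (v - u) \<le> w \<le> z\<close>, and can raise it only if \<open>z \<le> w \<le> z + (v - u)\<close>. The
  two directions are kept apart because an interval on both sides of \<open>z\<close> would push the final
  constant above 9.4. The remaining term \<open>r\<close> bounds the variation of \<open>t * stein_sol z t\<close>.
\<close>

lemma stein_sol_increment:
  assumes uv: "u \<le> v" and w: "w \<in> {u..v}"
  defines "r \<equiv> (\<bar>w\<bar> + sqrt (2 * pi) / 2) * (v - u)"
  shows "(stein_deriv z w - indicator {z - (v - u)..z} w - r) * (v - u) \<le> stein_sol z v - stein_sol z u" (is ?lower)
    and "stein_sol z v - stein_sol z u \<le> (stein_deriv z w + indicator {z..z + (v - u)} w + r) * (v - u)" (is ?upper)
proof -
  have lip: "\<bar>t * stein_sol z t - w * stein_sol z w\<bar> \<le> r" if t: "u < t" "t < v" for t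
  proof -
    have tw: "\<bar>t - w\<bar> \<le> v - u" using t w by auto
    have "t * stein_sol z t - w * stein_sol z w
        = w * (stein_sol z t - stein_sol z w) + (t - w) * stein_sol z t"
      by (simp add: algebra_simps)
    also have "\<bar>\<dots>\<bar> \<le> \<bar>w\<bar> * \<bar>stein_sol z t - stein_sol z w\<bar> + \<bar>t - w\<bar> * stein_sol z t"
      using stein_sol_nonneg by (metis abs_mult abs_of_nonneg abs_triangle_ineq)
    also have "\<dots> \<le> \<bar>w\<bar> * (v - u) + (v - u) * (sqrt (2 * pi) / 2)"
      using tw stein_sol_lipschitz[of z t w] stein_sol_le stein_sol_nonneg
      by (intro add_mono mult_mono) auto
    finally show ?thesis by (simp add: r_def algebra_simps)
  qed
  show ?lower
  proof (rule increment_ge_except_one_point[OF uv continuous_on_stein_sol, where z = z])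
    fix t assume t: "u < t" "t < v" "t \<noteq> z"
    have "stein_deriv z w - indicator {z - (v - u)..z} w - r \<le> stein_deriv z t"
      using lip[OF t(1,2)] w t unfolding stein_deriv_def by (auto simp: indicator_def split: if_splits)
    then show "(stein_sol z has_real_derivative stein_deriv z t) (at t) \<and>
        stein_deriv z w - indicator {z - (v - u)..z} w - r \<le> stein_deriv z t"
      using DERIV_stein_sol[OF t(3)] by simp
  qed
  show ?upper
  proof (rule increment_le_except_one_point[OF uv continuous_on_stein_sol, where z = z])
    fix t assume t: "u < t" "t < v" "t \<noteq> z"
    have "stein_deriv z t \<le> stein_deriv z w + indicator {z..z + (v - u)} w + r"
      using lip[OF t(1,2)] w t unfolding stein_deriv_def by (auto simp: indicator_def split: if_splits)
    then show "(stein_sol z has_real_derivative stein_deriv z t) (at t) \<and>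
        stein_deriv z t \<le> stein_deriv z w + indicator {z..z + (v - u)} w + r"
      using DERIV_stein_sol[OF t(3)] by simp
  qed
qed

section \<open>Stein's method for weighted sums of Bernoulli variables\<close>

locale bernoulli_weighted_sum = prob_space M for M :: "'a measure" +
  fixes J :: "'i set" and Y :: "'i \<Rightarrow> 'a \<Rightarrow> real" and pr x :: "'i \<Rightarrow> real"
  assumes finite_J: "finite J"
    and indep: "indep_vars (\<lambda>_. borel) Y J"
    and zero_one: "\<And>j \<omega>. j \<in> J \<Longrightarrow> \<omega> \<in> space M \<Longrightarrow> Y j \<omega> \<in> {0, 1}"
    and mean: "\<And>j. j \<in> J \<Longrightarrow> expectation (Y j) = pr j"
    and unit_variance: "(\<Sum>j\<in>J. (x j)\<^sup>2 * pr j * (1 - pr j)) = 1"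
begin

definition W :: "'a \<Rightarrow> real" where
  "W \<omega> = (\<Sum>j\<in>J. x j * (Y j \<omega> - pr j))"

text \<open>The sum \<open>W\<close> with the value of \<open>Y j\<close> replaced by \<open>b\<close>, which makes it independent of \<open>Y j\<close>.\<close>

definition W_at :: "'i \<Rightarrow> real \<Rightarrow> 'a \<Rightarrow> real" where
  "W_at j b \<omega> = (\<Sum>k\<in>J - {j}. x k * (Y k \<omega> - pr k)) + x j * (b - pr j)"

definition v :: "'i \<Rightarrow> real" where
  "v j = pr j * (1 - pr j)"

definition \<beta> :: real where
  "\<beta> = (\<Sum>j\<in>J. v j * \<bar>x j\<bar> ^ 3)"

lemma Y_measurable [measurable]: "j \<in> J \<Longrightarrow> random_variable borel (Y j)"
  using indep by (auto simp: indep_vars_def)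

lemma Y_integrable [simp]: "j \<in> J \<Longrightarrow> integrable M (Y j)"
  using zero_one by (intro integrable_const_bound[where B=1]) (force intro!: AE_I2)+

lemma W_integrable [simp]: "integrable M W"
  unfolding W_def[abs_def] by (intro Bochner_Integration.integrable_sum) auto

lemma W_at_integrable [simp]: "integrable M (W_at j b)"
  unfolding W_at_def[abs_def]
  by (intro Bochner_Integration.integrable_add Bochner_Integration.integrable_sum) auto

lemma W_measurable [measurable]: "random_variable borel W"
  and W_at_measurable [measurable]: "random_variable borel (W_at j b)"
  using borel_measurable_integrable[OF W_integrable]
    borel_measurable_integrable[OF W_at_integrable] by auto

lemma pr_range: "j \<in> J \<Longrightarrow> 0 \<le> pr j" "j \<in> J \<Longrightarrow> pr j \<le> 1"
proof -
  assume j: "j \<in> J"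
  have "0 \<le> expectation (Y j)"
    using zero_one[OF j] by (intro integral_nonneg_AE AE_I2) force
  then show "0 \<le> pr j" by (simp add: mean[OF j])
  have "expectation (Y j) \<le> expectation (\<lambda>_. 1)"
    using zero_one[OF j] by (intro integral_mono_AE AE_I2) (use j in force)+
  then show "pr j \<le> 1" by (simp add: mean[OF j] prob_space)
qed

lemma v_nonneg: "j \<in> J \<Longrightarrow> 0 \<le> v j"
  using pr_range[of j] by (simp add: v_def)

lemma sum_v_squares: "(\<Sum>j\<in>J. v j * (x j)\<^sup>2) = 1"
  using unit_variance by (simp add: v_def mult_ac)

lemma W_eq_W_at:
  assumes "j \<in> J"
  shows "W \<omega> = W_at j (Y j \<omega>) \<omega>"
  unfolding W_def W_at_def using assms finite_J by (subst sum.remove[of J j]) auto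

lemma W_at_diff: "W_at j 1 \<omega> - W_at j 0 \<omega> = x j"
  by (simp add: W_at_def algebra_simps)

lemma indep_W_at:
  assumes j: "j \<in> J" and [measurable]: "G \<in> borel_measurable borel"
  shows "indep_var borel (Y j) borel (\<lambda>\<omega>. G (W_at j b \<omega>))"
proof -
  let ?g = "\<lambda>f. G ((\<Sum>k\<in>J - {j}. x k * (f k - pr k)) + x j * (b - pr j))"
  have "indep_var (PiM {j} (\<lambda>_. borel)) (\<lambda>\<omega>. restrict (\<lambda>i. Y i \<omega>) {j})
      (PiM (J - {j}) (\<lambda>_. borel)) (\<lambda>\<omega>. restrict (\<lambda>i. Y i \<omega>) (J - {j}))"
    using j by (intro indep_var_restrict[OF indep]) auto
  then have "indep_var borel ((\<lambda>f. f j) \<circ> (\<lambda>\<omega>. restrict (\<lambda>i. Y i \<omega>) {j}))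
      borel (?g \<circ> (\<lambda>\<omega>. restrict (\<lambda>i. Y i \<omega>) (J - {j})))"
    by (rule indep_var_compose) measurable
  moreover have "?g (restrict (\<lambda>i. Y i \<omega>) (J - {j})) = G (W_at j b \<omega>)" for \<omega>
    unfolding W_at_def by (intro arg_cong[where f = G] arg_cong2[where f = "(+)"] sum.cong) auto
  ultimately show ?thesis by (simp add: comp_def)
qed

text \<open>
  Since \<open>Y j\<close> is \<open>0\<close> or \<open>1\<close>, \<open>(Y j - pr j) * G W\<close> is a combination of \<open>G (W_at j 0)\<close> and
  \<open>G (W_at j 1)\<close> with coefficients that depend on \<open>Y j\<close> only, and independence separates the factors.
\<close>

lemma stein_identity_term:
  assumes j: "j \<in> J" and G: "G \<in> borel_measurable borel"
    and int: "\<And>b. integrable M (\<lambda>\<omega>. G (W_at j b \<omega>))"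
  shows "integrable M (\<lambda>\<omega>. (Y j \<omega> - pr j) * G (W \<omega>))"
    and "expectation (\<lambda>\<omega>. (Y j \<omega> - pr j) * G (W \<omega>))
      = v j * expectation (\<lambda>\<omega>. G (W_at j 1 \<omega>) - G (W_at j 0 \<omega>))"
proof -
  note ind = indep_W_at[OF j G]
  have YG: "integrable M (\<lambda>\<omega>. Y j \<omega> * G (W_at j b \<omega>))"
    "expectation (\<lambda>\<omega>. Y j \<omega> * G (W_at j b \<omega>)) = pr j * expectation (\<lambda>\<omega>. G (W_at j b \<omega>))" for b
    using indep_var_integrable[OF ind _ int] indep_var_lebesgue_integral[OF ind _ int] mean[OF j] j
    by auto
  let ?h = "\<lambda>\<omega>. (1 - pr j) * (Y j \<omega> * G (W_at j 1 \<omega>)) - pr j * (G (W_at j 0 \<omega>) - Y j \<omega> * G (W_at j 0 \<omega>))"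
  have eq: "(Y j \<omega> - pr j) * G (W \<omega>) = ?h \<omega>" if "\<omega> \<in> space M" for \<omega>
    using zero_one[OF j that] W_eq_W_at[OF j, of \<omega>] by auto
  have "integrable M ?h" using YG int by auto
  then show "integrable M (\<lambda>\<omega>. (Y j \<omega> - pr j) * G (W \<omega>))"
    by (rule iffD2[OF Bochner_Integration.integrable_cong[OF refl], rotated]) (rule eq)
  have "expectation (\<lambda>\<omega>. (Y j \<omega> - pr j) * G (W \<omega>)) = expectation ?h"
    using eq by (intro Bochner_Integration.integral_cong) auto
  also have "\<dots> = v j * expectation (\<lambda>\<omega>. G (W_at j 1 \<omega>) - G (W_at j 0 \<omega>))"
    using YG int by (simp add: v_def algebra_simps)
  finally show "expectation (\<lambda>\<omega>. (Y j \<omega> - pr j) * G (W \<omega>)) = \<dots>" .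
qed

text \<open>
  Dividing the increment by \<open>x j \<noteq> 0\<close> shows the meaning of the identity: \<open>v j * (x j)\<^sup>2\<close>, the variance of
  the \<open>j\<close>-th summand, weights the average slope of \<open>G\<close> between \<open>W_at j 0\<close> and \<open>W_at j 1\<close>. In other
  words, the zero-bias distribution of a centred Bernoulli variable is uniform.
\<close>

lemma stein_identity:
  assumes G: "G \<in> borel_measurable borel"
    and int: "\<And>j b. integrable M (\<lambda>\<omega>. G (W_at j b \<omega>))"
  shows "integrable M (\<lambda>\<omega>. W \<omega> * G (W \<omega>))"
    and "expectation (\<lambda>\<omega>. W \<omega> * G (W \<omega>))
      = (\<Sum>j\<in>J. v j * expectation (\<lambda>\<omega>. x j * (G (W_at j 1 \<omega>) - G (W_at j 0 \<omega>))))"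
proof -
  have eq: "W \<omega> * G (W \<omega>) = (\<Sum>j\<in>J. x j * ((Y j \<omega> - pr j) * G (W \<omega>)))" for \<omega>
    by (subst (1) W_def) (simp add: sum_distrib_right mult.assoc)
  note T = stein_identity_term[OF _ G int]
  show "integrable M (\<lambda>\<omega>. W \<omega> * G (W \<omega>))"
    unfolding eq by (intro Bochner_Integration.integrable_sum integrable_mult_right T)
  show "expectation (\<lambda>\<omega>. W \<omega> * G (W \<omega>))
      = (\<Sum>j\<in>J. v j * expectation (\<lambda>\<omega>. x j * (G (W_at j 1 \<omega>) - G (W_at j 0 \<omega>))))"
    unfolding eq using T
    by (subst Bochner_Integration.integral_sum) (auto intro!: sum.cong simp del: Bochner_Integration.integral_diff)
qed

lemma stein_identity_bounded:
  assumes G: "G \<in> borel_measurable borel" and bd: "\<And>w. \<bar>G w\<bar> \<le> B"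
  shows "integrable M (\<lambda>\<omega>. W \<omega> * G (W \<omega>))"
    and "integrable M (\<lambda>\<omega>. x j * (G (W_at j 1 \<omega>) - G (W_at j 0 \<omega>)))"
    and "expectation (\<lambda>\<omega>. W \<omega> * G (W \<omega>))
      = (\<Sum>j\<in>J. v j * expectation (\<lambda>\<omega>. x j * (G (W_at j 1 \<omega>) - G (W_at j 0 \<omega>))))"
proof -
  note [measurable] = G
  have int: "integrable M (\<lambda>\<omega>. G (W_at j b \<omega>))" for j b
    using bd by (intro integrable_const_bound[where B=B]) auto
  show "integrable M (\<lambda>\<omega>. W \<omega> * G (W \<omega>))"
    "integrable M (\<lambda>\<omega>. x j * (G (W_at j 1 \<omega>) - G (W_at j 0 \<omega>)))"
    "expectation (\<lambda>\<omega>. W \<omega> * G (W \<omega>))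
      = (\<Sum>j\<in>J. v j * expectation (\<lambda>\<omega>. x j * (G (W_at j 1 \<omega>) - G (W_at j 0 \<omega>))))"
    using stein_identity[OF G int] int by auto
qed

text \<open>
  The identity for \<open>G w = w\<close>.
\<close>

lemma expectation_W_squared: "expectation (\<lambda>\<omega>. W \<omega> * W \<omega>) = 1" "integrable M (\<lambda>\<omega>. W \<omega> * W \<omega>)"
  using stein_identity[of "\<lambda>w. w"] sum_v_squares
  by (auto simp: W_at_diff prob_space power2_eq_square)

lemma expectation_abs_W_le: "expectation (\<lambda>\<omega>. \<bar>W \<omega>\<bar>) \<le> 1"
proof -
  have "expectation (\<lambda>\<omega>. \<bar>W \<omega>\<bar>) \<le> expectation (\<lambda>\<omega>. (1 + W \<omega> * W \<omega>) / 2)"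
  proof (rule integral_mono)
    fix \<omega>
    have "0 \<le> (\<bar>W \<omega>\<bar> - 1)\<^sup>2" by simp
    then show "\<bar>W \<omega>\<bar> \<le> (1 + W \<omega> * W \<omega>) / 2" by (simp add: power2_eq_square algebra_simps)
  qed (use expectation_W_squared in auto)
  also have "\<dots> = 1" using expectation_W_squared by (simp add: prob_space)
  finally show ?thesis .
qed

lemma beta_pos: "0 < \<beta>"
proof -
  have "\<exists>j\<in>J. v j * (x j)\<^sup>2 \<noteq> 0"
  proof (rule ccontr)
    assume "\<not> (\<exists>j\<in>J. v j * (x j)\<^sup>2 \<noteq> 0)"
    then have "(\<Sum>j\<in>J. v j * (x j)\<^sup>2) = 0" by (intro sum.neutral) blast
    then show False using sum_v_squares by simp
  qed
  then obtain j where j: "j \<in> J" "v j * (x j)\<^sup>2 \<noteq> 0" by blast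
  then have "0 < v j * \<bar>x j\<bar> ^ 3" using v_nonneg[of j] by (simp add: less_le)
  moreover have "\<And>k. k \<in> J \<Longrightarrow> 0 \<le> v k * \<bar>x k\<bar> ^ 3" using v_nonneg by simp
  ultimately show ?thesis unfolding \<beta>_def using j finite_J by (intro sum_pos2) auto
qed

text \<open>
  Orients the increment: whatever the sign of \<open>x j\<close>, it is taken from left to right over an interval
  of length \<open>\<bar>x j\<bar>\<close>, and \<open>W\<close>, which equals \<open>W_at j 0\<close> or \<open>W_at j 1\<close>, is one of its end points.
\<close>

lemma W_between:
  assumes "j \<in> J" "\<omega> \<in> space M"
  obtains u where "W \<omega> \<in> {u..u + \<bar>x j\<bar>}"
    "\<And>G :: real \<Rightarrow> real. x j * (G (W_at j 1 \<omega>) - G (W_at j 0 \<omega>)) = \<bar>x j\<bar> * (G (u + \<bar>x j\<bar>) - G u)"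
    "W \<omega> = u \<or> W \<omega> = u + \<bar>x j\<bar>"
proof
  let ?u = "min (W_at j 0 \<omega>) (W_at j 1 \<omega>)"
  have d: "W_at j 1 \<omega> = W_at j 0 \<omega> + x j" using W_at_diff[of j \<omega>] by simp
  have W: "W \<omega> = W_at j 0 \<omega> \<or> W \<omega> = W_at j 0 \<omega> + x j"
    using zero_one[OF assms] W_eq_W_at[OF assms(1), of \<omega>] d by auto
  show "W \<omega> \<in> {?u..?u + \<bar>x j\<bar>}" "W \<omega> = ?u \<or> W \<omega> = ?u + \<bar>x j\<bar>" using W d by (auto simp: min_def)
  show "x j * (G (W_at j 1 \<omega>) - G (W_at j 0 \<omega>)) = \<bar>x j\<bar> * (G (?u + \<bar>x j\<bar>) - G ?u)" for G :: "real \<Rightarrow> real"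
    using d by (cases "0 \<le> x j") (auto simp: min_def abs_if algebra_simps)
qed

lemma indicator_W:
  assumes [measurable]: "A \<in> sets borel"
  shows "integrable M (\<lambda>\<omega>. indicat_real A (W \<omega>))"
    and "expectation (\<lambda>\<omega>. indicat_real A (W \<omega>)) = \<P>(\<omega> in M. W \<omega> \<in> A)"
proof -
  show "integrable M (\<lambda>\<omega>. indicat_real A (W \<omega>))"
    by (intro integrable_const_bound[where B=1]) auto
  have "expectation (\<lambda>\<omega>. indicat_real A (W \<omega>))
      = expectation (indicat_real {\<omega> \<in> space M. W \<omega> \<in> A})"
    by (intro Bochner_Integration.integral_cong) (auto simp: indicator_def)
  then show "expectation (\<lambda>\<omega>. indicat_real A (W \<omega>)) = \<P>(\<omega> in M. W \<omega> \<in> A)" by simp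
qed

text \<open>
  The test function \<open>G\<close> has slope 1 on \<open>[a - \<beta>/2, b + \<beta>/2]\<close>, is constant outside, and is
  centred so that \<open>\<bar>G\<bar> \<le> m = (b - a + \<beta>) / 2\<close>. On the event \<open>a \<le> W \<le> b\<close> the increments bound
  \<open>E (W * G W)\<close> from below by half the probability of the event, and \<open>E \<bar>W\<bar> \<le> 1\<close> bounds it from above
  by \<open>m\<close>.
\<close>

lemma concentration:
  assumes ab: "a \<le> b"
  shows "\<P>(\<omega> in M. W \<omega> \<in> {a..b}) \<le> (b - a) + \<beta>"
proof -
  define m where "m = (b - a + \<beta>) / 2"
  define G where "G w = max (- m) (min m (w - (a + b) / 2))" for w
  let ?I = "\<lambda>\<omega>. indicator {a..b} (W \<omega>) :: real"
  have m: "0 \<le> m" using ab beta_pos by (simp add: m_def)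
  have Gm [measurable]: "G \<in> borel_measurable borel" unfolding G_def[abs_def] by measurable
  have Gb: "\<bar>G w\<bar> \<le> m" for w using m by (auto simp: G_def)
  note S = stein_identity_bounded[OF Gm Gb]
  have I: "integrable M ?I" and EI: "expectation ?I = \<P>(\<omega> in M. W \<omega> \<in> {a..b})"
    by (simp_all add: indicator_W)
  have step: "?I \<omega> * ((x j)\<^sup>2 - \<bar>x j\<bar> ^ 3 / (2 * \<beta>)) \<le> x j * (G (W_at j 1 \<omega>) - G (W_at j 0 \<omega>))"
    if j: "j \<in> J" and \<omega>: "\<omega> \<in> space M" for j \<omega>
  proof -
    obtain u where u: "W \<omega> = u \<or> W \<omega> = u + \<bar>x j\<bar>"
      "x j * (G (W_at j 1 \<omega>) - G (W_at j 0 \<omega>)) = \<bar>x j\<bar> * (G (u + \<bar>x j\<bar>) - G u)"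
      using W_between[OF j \<omega>] by metis
    \<comment> \<open>\<open>min \<delta> y \<ge> y - y\<^sup>2 / (4 \<delta>)\<close> for \<open>\<delta> = \<beta> / 2\<close> and \<open>y = \<bar>x j\<bar>\<close>: this linearisation
      makes the sum over \<open>j\<close> computable.\<close>
    have "0 \<le> (\<bar>x j\<bar> - \<beta>)\<^sup>2" by simp
    then have quad: "\<bar>x j\<bar> - (\<bar>x j\<bar> ^ 2) / (2 * \<beta>) \<le> \<beta> / 2"
      using beta_pos by (simp add: field_simps power2_eq_square)
    have lin: "\<bar>x j\<bar> - (\<bar>x j\<bar> ^ 2) / (2 * \<beta>) \<le> \<bar>x j\<bar>" using beta_pos by simp
    have "?I \<omega> * (\<bar>x j\<bar> - (\<bar>x j\<bar> ^ 2) / (2 * \<beta>)) \<le> G (u + \<bar>x j\<bar>) - G u"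
    proof (cases "W \<omega> \<in> {a..b}")
      case True
      then have "min (\<beta> / 2) \<bar>x j\<bar> \<le> G (u + \<bar>x j\<bar>) - G u"
        using u(1) beta_pos unfolding G_def m_def by (auto simp: min_def max_def field_simps)
      then show ?thesis using True quad lin by simp
    next
      case False
      then show ?thesis by (auto simp: G_def)
    qed
    then have "\<bar>x j\<bar> * (?I \<omega> * (\<bar>x j\<bar> - (\<bar>x j\<bar> ^ 2) / (2 * \<beta>))) \<le> \<bar>x j\<bar> * (G (u + \<bar>x j\<bar>) - G u)"
      by (intro mult_left_mono) auto
    then show ?thesis unfolding u(2) power2_abs[of "x j", symmetric]
      by (simp add: algebra_simps power2_eq_square power3_eq_cube del: abs_mult_self_eq)
  qed
  \<comment> \<open>The coefficients sum to \<open>1 - \<beta> / (2 * \<beta>) = 1 / 2\<close>; the margin \<open>\<beta> / 2\<close> around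
      \<open>[a, b]\<close> is proportional to \<open>\<beta>\<close> for this reason.\<close>
  have "\<P>(\<omega> in M. W \<omega> \<in> {a..b}) * (1 / 2)
      = expectation ?I * (\<Sum>j\<in>J. v j * ((x j)\<^sup>2 - \<bar>x j\<bar> ^ 3 / (2 * \<beta>)))"
  proof -
    have "(\<Sum>j\<in>J. v j * ((x j)\<^sup>2 - \<bar>x j\<bar> ^ 3 / (2 * \<beta>))) = 1 - \<beta> / (2 * \<beta>)"
      by (simp add: right_diff_distrib sum_subtractf sum_v_squares \<beta>_def sum_divide_distrib)
    then show ?thesis using beta_pos EI by simp
  qed
  also have "\<dots> = (\<Sum>j\<in>J. v j * expectation (\<lambda>\<omega>. ?I \<omega> * ((x j)\<^sup>2 - \<bar>x j\<bar> ^ 3 / (2 * \<beta>))))"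
    using I by (simp add: sum_distrib_left mult_ac)
  also have "\<dots> \<le> (\<Sum>j\<in>J. v j * expectation (\<lambda>\<omega>. x j * (G (W_at j 1 \<omega>) - G (W_at j 0 \<omega>))))"
    using step S(2) I by (intro sum_mono mult_left_mono integral_mono_AE AE_I2 v_nonneg) auto
  also have "\<dots> = expectation (\<lambda>\<omega>. W \<omega> * G (W \<omega>))" using S(3) by simp
  also have "\<dots> \<le> expectation (\<lambda>\<omega>. m * \<bar>W \<omega>\<bar>)"
  proof (rule integral_mono[OF S(1)])
    fix \<omega>
    have "W \<omega> * G (W \<omega>) \<le> \<bar>W \<omega>\<bar> * \<bar>G (W \<omega>)\<bar>" by (metis abs_ge_self abs_mult)
    also have "\<dots> \<le> \<bar>W \<omega>\<bar> * m" using Gb by (intro mult_left_mono) auto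
    finally show "W \<omega> * G (W \<omega>) \<le> m * \<bar>W \<omega>\<bar>" by (simp add: mult.commute)
  qed auto
  also have "\<dots> \<le> m * 1" using m expectation_abs_W_le by (simp add: mult_left_le)
  finally show ?thesis by (simp add: m_def)
qed

text \<open>
  By Stein's equation the difference equals \<open>E (stein_deriv z W) - E (W * stein_sol z W)\<close>. The Stein
  identity turns the second term into an average, with weights \<open>v j * (x j)\<^sup>2\<close> that sum to 1, of
  slopes of \<open>stein_sol z\<close>, and \<open>stein_sol_increment\<close> compares each slope with \<open>stein_deriv z W\<close>. The
  \<open>j\<close>-th error is at most \<open>\<bar>x j\<bar> + \<beta>\<close> from the jump, by concentration, plus
  \<open>(1 + sqrt (2 * pi) / 2) * \<bar>x j\<bar>\<close> from the Lipschitz part, by \<open>E \<bar>W\<bar> \<le> 1\<close>.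
\<close>

theorem berry_esseen: "\<bar>\<P>(\<omega> in M. W \<omega> \<le> z) - Phi z\<bar> \<le> (3 + sqrt (2 * pi) / 2) * \<beta>"
proof -
  define c where "c = sqrt (2 * pi) / 2"
  have c: "0 \<le> c" by (simp add: c_def)
  let ?f = "stein_sol z" and ?h = "stein_deriv z"
  have fm [measurable]: "?f \<in> borel_measurable borel"
    by (intro borel_measurable_continuous_onI continuous_on_stein_sol)
  have fb: "\<bar>?f w\<bar> \<le> c" for w
    using stein_sol_nonneg[of z w] stein_sol_le[of z w] by (simp add: c_def)
  note S = stein_identity_bounded[OF fm fb]
  note ind = indicator_W
  have h_int: "integrable M (\<lambda>\<omega>. ?h (W \<omega>))"
    unfolding stein_deriv_def using S(1) ind(1)[of "{..z}"] by auto
  have diff: "\<P>(\<omega> in M. W \<omega> \<le> z) - Phi z = expectation (\<lambda>\<omega>. ?h (W \<omega>)) - expectation (\<lambda>\<omega>. W \<omega> * ?f (W \<omega>))"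
    unfolding stein_deriv_def using S(1) ind[of "{..z}"] by (simp add: prob_space)
  \<comment> \<open>The total of the errors; \<open>s = - 1\<close> serves the lower and \<open>s = 1\<close> the upper estimate.\<close>
  have const: "(\<Sum>j\<in>J. v j * (x j)\<^sup>2 * (e + (\<bar>x j\<bar> + \<beta> + (1 + c) * \<bar>x j\<bar>) * s)) = e + s * (3 + c) * \<beta>" for e s :: real
  proof -
    have "v j * (x j)\<^sup>2 * (e + (\<bar>x j\<bar> + \<beta> + (1 + c) * \<bar>x j\<bar>) * s)
        = (e + s * \<beta>) * (v j * (x j)\<^sup>2) + s * (2 + c) * (v j * \<bar>x j\<bar> ^ 3)" for j
      by (simp add: algebra_simps power3_eq_cube power2_eq_square)
    then show ?thesis
      by (simp add: sum.distrib sum_v_squares flip: sum_distrib_left \<beta>_def) (simp add: algebra_simps)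
  qed
  let ?r = "\<lambda>j \<omega>. (\<bar>W \<omega>\<bar> + c) * \<bar>x j\<bar>"
  have r: "integrable M (?r j)" "expectation (?r j) \<le> (1 + c) * \<bar>x j\<bar>" for j
  proof -
    show "integrable M (?r j)" by auto
    have "expectation (?r j) = (expectation (\<lambda>\<omega>. \<bar>W \<omega>\<bar>) + c) * \<bar>x j\<bar>"
      using prob_space by simp
    also have "\<dots> \<le> (1 + c) * \<bar>x j\<bar>"
      using expectation_abs_W_le by (intro mult_right_mono) auto
    finally show "expectation (?r j) \<le> (1 + c) * \<bar>x j\<bar>" .
  qed
  let ?D = "\<lambda>j \<omega>. x j * (?f (W_at j 1 \<omega>) - ?f (W_at j 0 \<omega>))"
  let ?L = "\<lambda>j. {z - \<bar>x j\<bar>..z}" and ?U = "\<lambda>j. {z..z + \<bar>x j\<bar>}"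
  have D: "(x j)\<^sup>2 * (?h (W \<omega>) - indicator (?L j) (W \<omega>) - ?r j \<omega>) \<le> ?D j \<omega>"
       "?D j \<omega> \<le> (x j)\<^sup>2 * (?h (W \<omega>) + indicator (?U j) (W \<omega>) + ?r j \<omega>)"
    if j: "j \<in> J" and \<omega>: "\<omega> \<in> space M" for j \<omega>
  proof -
    obtain u where u: "W \<omega> \<in> {u..u + \<bar>x j\<bar>}" "?D j \<omega> = \<bar>x j\<bar> * (?f (u + \<bar>x j\<bar>) - ?f u)"
      using W_between[OF j \<omega>] by metis
    note inc = stein_sol_increment[OF _ u(1), of z, simplified, folded c_def]
    have sq: "(x j)\<^sup>2 * t = \<bar>x j\<bar> * (t * \<bar>x j\<bar>)" for t
      by (simp add: power2_eq_square algebra_simps)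
    show "(x j)\<^sup>2 * (?h (W \<omega>) - indicator (?L j) (W \<omega>) - ?r j \<omega>) \<le> ?D j \<omega>"
      unfolding sq u(2) by (intro mult_left_mono inc) auto
    show "?D j \<omega> \<le> (x j)\<^sup>2 * (?h (W \<omega>) + indicator (?U j) (W \<omega>) + ?r j \<omega>)"
      unfolding sq u(2) by (intro mult_left_mono inc) auto
  qed
  let ?Eh = "expectation (\<lambda>\<omega>. ?h (W \<omega>))"
  have "?Eh - (3 + c) * \<beta> = (\<Sum>j\<in>J. v j * (x j)\<^sup>2 * (?Eh + (\<bar>x j\<bar> + \<beta> + (1 + c) * \<bar>x j\<bar>) * (- 1)))"
    by (subst const) (simp add: algebra_simps)
  also have "\<dots> \<le> (\<Sum>j\<in>J. v j * expectation (?D j))"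
  proof (rule sum_mono)
    fix j assume j: "j \<in> J"
    have "(x j)\<^sup>2 * (?Eh + (\<bar>x j\<bar> + \<beta> + (1 + c) * \<bar>x j\<bar>) * (- 1))
        \<le> (x j)\<^sup>2 * (?Eh - \<P>(\<omega> in M. W \<omega> \<in> ?L j) - expectation (?r j))"
      using concentration[of "z - \<bar>x j\<bar>" z] r(2)[of j] by (intro mult_left_mono) auto
    also have "\<dots> = expectation (\<lambda>\<omega>. (x j)\<^sup>2 * (?h (W \<omega>) - indicator (?L j) (W \<omega>) - ?r j \<omega>))"
      using h_int ind[of "?L j"] r(1)[of j] by simp
    also have "\<dots> \<le> expectation (?D j)"
      using D(1)[OF j] S(2) h_int ind[of "?L j"] r(1)[of j] by (intro integral_mono_AE AE_I2) auto
    finally show "v j * (x j)\<^sup>2 * (?Eh + (\<bar>x j\<bar> + \<beta> + (1 + c) * \<bar>x j\<bar>) * (- 1)) \<le> v j * expectation (?D j)"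
      using v_nonneg[OF j] by (simp only: mult.assoc mult_left_mono)
  qed
  finally have lower: "?Eh - (3 + c) * \<beta> \<le> expectation (\<lambda>\<omega>. W \<omega> * ?f (W \<omega>))" using S(3) by simp
  have "(\<Sum>j\<in>J. v j * expectation (?D j))
      \<le> (\<Sum>j\<in>J. v j * (x j)\<^sup>2 * (?Eh + (\<bar>x j\<bar> + \<beta> + (1 + c) * \<bar>x j\<bar>) * 1))"
  proof (rule sum_mono)
    fix j assume j: "j \<in> J"
    have "expectation (?D j) \<le> expectation (\<lambda>\<omega>. (x j)\<^sup>2 * (?h (W \<omega>) + indicator (?U j) (W \<omega>) + ?r j \<omega>))"
      using D(2)[OF j] S(2) h_int ind[of "?U j"] r(1)[of j] by (intro integral_mono_AE AE_I2) auto
    also have "\<dots> = (x j)\<^sup>2 * (?Eh + \<P>(\<omega> in M. W \<omega> \<in> ?U j) + expectation (?r j))"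
      using h_int ind[of "?U j"] r(1)[of j] by simp
    also have "\<dots> \<le> (x j)\<^sup>2 * (?Eh + (\<bar>x j\<bar> + \<beta> + (1 + c) * \<bar>x j\<bar>) * 1)"
      using concentration[of z "z + \<bar>x j\<bar>"] r(2)[of j] by (intro mult_left_mono) auto
    finally show "v j * expectation (?D j) \<le> v j * (x j)\<^sup>2 * (?Eh + (\<bar>x j\<bar> + \<beta> + (1 + c) * \<bar>x j\<bar>) * 1)"
      using v_nonneg[OF j] by (simp only: mult.assoc mult_left_mono)
  qed
  also have "\<dots> = ?Eh + (3 + c) * \<beta>" by (subst const) simp
  finally have upper: "expectation (\<lambda>\<omega>. W \<omega> * ?f (W \<omega>)) \<le> ?Eh + (3 + c) * \<beta>" using S(3) by simp
  show ?thesis using lower upper diff unfolding c_def by (simp add: abs_le_iff)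
qed

text \<open>
  The \<open>j\<close>-th absolute third moment is \<open>v j * \<bar>x j\<bar> ^ 3 * ((1 - pr j)\<^sup>2 + (pr j)\<^sup>2)\<close>, and the last
  factor is at least \<open>1 / 2\<close>.
\<close>

lemma beta_le_third_moments: "\<beta> \<le> 2 * (\<Sum>j\<in>J. expectation (\<lambda>\<omega>. \<bar>x j * (Y j \<omega> - pr j)\<bar> ^ 3))"
proof -
  have "v j * \<bar>x j\<bar> ^ 3 \<le> 2 * expectation (\<lambda>\<omega>. \<bar>x j * (Y j \<omega> - pr j)\<bar> ^ 3)" if j: "j \<in> J" for j
  proof -
    let ?p = "pr j"
    have "expectation (\<lambda>\<omega>. \<bar>x j * (Y j \<omega> - ?p)\<bar> ^ 3)
        = expectation (\<lambda>\<omega>. \<bar>x j\<bar> ^ 3 * (Y j \<omega> * (1 - ?p) ^ 3 + (1 - Y j \<omega>) * ?p ^ 3))"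
    proof (rule Bochner_Integration.integral_cong[OF refl])
      fix \<omega> assume \<omega>: "\<omega> \<in> space M"
      show "\<bar>x j * (Y j \<omega> - ?p)\<bar> ^ 3 = \<bar>x j\<bar> ^ 3 * (Y j \<omega> * (1 - ?p) ^ 3 + (1 - Y j \<omega>) * ?p ^ 3)"
        using zero_one[OF j \<omega>] pr_range[OF j] by (auto simp: abs_mult power_mult_distrib)
    qed
    also have "\<dots> = \<bar>x j\<bar> ^ 3 * (?p * (1 - ?p) ^ 3 + (1 - ?p) * ?p ^ 3)"
      using j by (simp add: mean prob_space)
    also have "?p * (1 - ?p) ^ 3 + (1 - ?p) * ?p ^ 3 = v j * ((1 - ?p)\<^sup>2 + ?p\<^sup>2)"
      by (simp add: v_def power2_eq_square power3_eq_cube algebra_simps)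
    finally have *: "2 * expectation (\<lambda>\<omega>. \<bar>x j * (Y j \<omega> - ?p)\<bar> ^ 3)
        = (v j * \<bar>x j\<bar> ^ 3) * (2 * ((1 - ?p)\<^sup>2 + ?p\<^sup>2))" by simp
    have "0 \<le> (2 * ?p - 1)\<^sup>2" by simp
    then have "1 \<le> 2 * ((1 - ?p)\<^sup>2 + ?p\<^sup>2)" by (simp add: power2_eq_square algebra_simps)
    then show ?thesis unfolding *
      using mult_left_mono[of 1 "2 * ((1 - ?p)\<^sup>2 + ?p\<^sup>2)" "v j * \<bar>x j\<bar> ^ 3"] v_nonneg[OF j] by simp
  qed
  then show ?thesis unfolding \<beta>_def sum_distrib_left by (intro sum_mono)
qed

corollary berry_esseen_third_moments:
  "\<bar>\<P>(\<omega> in M. W \<omega> \<le> z) - Phi z\<bar> \<le> 9.4 * (\<Sum>j\<in>J. expectation (\<lambda>\<omega>. \<bar>x j * (Y j \<omega> - pr j)\<bar> ^ 3))"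
proof -
  have "sqrt (2 * pi) \<le> sqrt (3\<^sup>2)" using pi_less_4 by (intro real_sqrt_le_mono) simp
  then have "3 + sqrt (2 * pi) / 2 \<le> 4.7" by simp
  then have "(3 + sqrt (2 * pi) / 2) * \<beta> \<le> 4.7 * \<beta>" using beta_pos by (intro mult_right_mono) auto
  then show ?thesis using berry_esseen[of z] beta_le_third_moments by simp
qed

end

section \<open>Independence of two-valued variables\<close>

text \<open>
  For two-valued variables the zero event alone generates the \<open>\<sigma>\<close>-algebra, so it suffices that
  these events multiply.
\<close>

lemma (in prob_space) indep_vars_zero_one:
  fixes Y :: "'i \<Rightarrow> 'a \<Rightarrow> real"
  assumes rv: "\<And>j. j \<in> J \<Longrightarrow> random_variable borel (Y j)"
    and zero_one: "\<And>j \<omega>. j \<in> J \<Longrightarrow> \<omega> \<in> space M \<Longrightarrow> Y j \<omega> \<in> {0, 1}"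
    and prod: "\<And>K. K \<subseteq> J \<Longrightarrow> finite K \<Longrightarrow> K \<noteq> {} \<Longrightarrow>
      \<P>(\<omega> in M. \<forall>j\<in>K. Y j \<omega> = 0) = (\<Prod>j\<in>K. \<P>(\<omega> in M. Y j \<omega> = 0))"
  shows "indep_vars (\<lambda>_. borel) Y J"
proof -
  let ?A = "\<lambda>j. {\<omega> \<in> space M. Y j \<omega> = 0}"
  have A: "?A j \<in> events" if "j \<in> J" for j
    using rv[OF that] by measurable
  have "indep_events ?A J"
  proof (rule indep_eventsI)
    fix K assume K: "K \<subseteq> J" "finite K" "K \<noteq> {}"
    have "(\<Inter>j\<in>K. ?A j) = {\<omega> \<in> space M. \<forall>j\<in>K. Y j \<omega> = 0}" using K(3) by auto
    then show "prob (\<Inter>j\<in>K. ?A j) = (\<Prod>j\<in>K. prob (?A j))" using prod[OF K] by simp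
  qed (rule A)
  then have "indep_sets (\<lambda>j. {?A j}) J" by (simp add: indep_events_def_alt)
  then have sig: "indep_sets (\<lambda>j. sigma_sets (space M) {?A j}) J"
    by (rule indep_sets_sigma) (simp add: Int_stable_def)
  have "indep_sets (\<lambda>j. {Y j -` B \<inter> space M | B. B \<in> sets borel}) J"
  proof (rule indep_sets_mono_sets[OF sig], rule subsetI)
    fix j X assume j: "j \<in> J" and "X \<in> {Y j -` B \<inter> space M | B. B \<in> sets borel}"
    then obtain B where X: "X = Y j -` B \<inter> space M" by auto
    have zo: "Y j \<omega> = 0 \<or> Y j \<omega> = 1" if "\<omega> \<in> space M" for \<omega> using zero_one[OF j that] by auto
    consider "0 \<in> B" "1 \<in> B" | "0 \<in> B" "1 \<notin> B" | "0 \<notin> B" "1 \<in> B" | "0 \<notin> B" "1 \<notin> B" by blast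
    then show "X \<in> sigma_sets (space M) {?A j}"
    proof cases
      case 1
      then have "X = space M" unfolding X using zo by fastforce
      then show ?thesis by (simp add: sigma_sets_top)
    next
      case 2
      then have "X = ?A j" unfolding X using zo by fastforce
      then show ?thesis by (simp add: sigma_sets.Basic)
    next
      case 3
      then have "X = space M - ?A j" unfolding X using zo by fastforce
      then show ?thesis by (simp add: sigma_sets.Basic sigma_sets.Compl)
    next
      case 4
      then have "X = {}" unfolding X using zo by fastforce
      then show ?thesis by (simp add: sigma_sets.Empty)
    qed
  qed
  then show ?thesis using rv by (simp add: indep_vars_def2)
qed

section \<open>The blockmodel conditioned on a type configuration\<close>

context bipartite_blockmodel
begin

lemma hit_eq:
  assumes "finite Q" "Q \<noteq> {}"
  shows "hit E Q j \<omega> = of_bool (\<exists>i\<in>Q. E i j \<omega>)"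
proof (cases "\<exists>i\<in>Q. E i j \<omega>")
  case True
  then show ?thesis using hit_eq_1_iff[OF assms] by simp
next
  case False
  then have "(\<lambda>i. of_bool (E i j \<omega>) :: real) ` Q = {0}" using assms(2) by auto
  then show ?thesis using False by (simp add: hit_def)
qed

lemma hit_measurable:
  assumes Q: "Q \<subseteq> {1..q}" "Q \<noteq> {}" and j: "j \<in> {1..d}"
  shows "random_variable borel (hit E Q j)"
proof -
  have fin: "finite Q" using Q finite_subset by blast
  have "{\<omega> \<in> space M. \<exists>i\<in>Q. E i j \<omega>} \<in> events"
    using Q j by (intro sets.sets_Collect_finite_Ex edge_event fin) auto
  then have "random_variable borel (indicat_real {\<omega> \<in> space M. \<exists>i\<in>Q. E i j \<omega>})"
    by (rule borel_measurable_indicator)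
  also have "?this \<longleftrightarrow> ?thesis"
    by (rule measurable_cong) (simp add: hit_eq[OF fin Q(2)] indicator_def)
  finally show ?thesis .
qed

lemma prob_cond_measure:
  assumes "Q \<subseteq> {1..q}" "{\<omega> \<in> space M. A \<omega>} \<in> events"
  shows "measure (cond_measure M s t Q d c) {\<omega> \<in> space M. A \<omega>} = \<P>(\<omega> in M. A \<omega> \<bar> config s t Q d \<omega> = c)"
  using measure_uniform_measure_eq_cond_prob[of A "\<lambda>\<omega>. config s t Q d \<omega> = c"] assms
    config_event[OF assms(1), of c]
  by (simp add: cond_measure_def pred_def)

text \<open>
  The model speaks about conditioning on all types, but the configuration \<open>c\<close> leaves the types of
  the agents outside \<open>Q\<close> open. For each full configuration \<open>a\<close> that extends \<open>c\<close> (the predicate \<open>?g\<close>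
  in the proof), the probability that no edge joins \<open>Q\<close> to \<open>J\<close> is a product over \<open>Q \<times> J\<close> that involves
  types recorded in \<open>c\<close> only. As it is the same for all \<open>a\<close>, it is also the probability given \<open>c\<close>.
\<close>

lemma cond_prob_no_hits:
  assumes Q: "Q \<subseteq> {1..q}" "Q \<noteq> {}" and J: "J \<subseteq> {1..d}" "J \<noteq> {}"
    and c: "c \<in> realisations M s t K L Q d"
  shows "\<P>(\<omega> in M. \<forall>j\<in>J. hit E Q j \<omega> = 0 \<bar> config s t Q d \<omega> = c) = (\<Prod>j\<in>J. 1 - hit_prob M s t E d Q j c)"
proof -
  let ?C = "config s t {1..q} d"
  let ?g = "\<lambda>a :: type_config. (restrict (fst a) Q, snd a) = c"
  have fin: "finite Q" "finite J" using Q J finite_subset by blast+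
  have g: "?g (?C \<omega>) \<longleftrightarrow> config s t Q d \<omega> = c" for \<omega>
  proof -
    have "{1..q} \<inter> Q = Q" using Q by auto
    then show ?thesis by (simp add: config_def restrict_restrict)
  qed
  have no_hit: "(\<forall>j\<in>J. hit E Q j \<omega> = 0) \<longleftrightarrow> (\<forall>j\<in>J. \<forall>i\<in>Q. \<not> E i j \<omega>)" for \<omega>
    using hit_eq[OF fin(1) Q(2)] by auto
  have ev: "{\<omega> \<in> space M. \<forall>j\<in>J. hit E Q j \<omega> = 0} \<in> events"
    unfolding no_hit using Q J
    by (intro sets.sets_Collect_finite_All sets.sets_Collect_neg edge_event fin) auto
  have "\<P>(\<omega> in M. \<forall>j\<in>J. hit E Q j \<omega> = 0 \<bar> ?C \<omega> = a) = (\<Prod>j\<in>J. 1 - hit_prob M s t E d Q j c)"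
    if a: "a \<in> realisations M s t K L {1..q} d" and ga: "?g a" for a
  proof -
    let ?U = "cond_measure M s t {1..q} d a"
    interpret U: prob_space ?U using prob_space_cond_measure[OF _ a] by simp
    have spU: "space ?U = space M" and seU: "sets ?U = events"
      by (simp_all add: cond_measure_def)
    have no_edge: "U.prob ((case e of (i, j) \<Rightarrow> E i j) -` {False} \<inter> space ?U)
        = 1 - p (fst c (fst e)) (snd c (snd e))" if e: "e \<in> Q \<times> J" for e
    proof -
      obtain i j where e_eq: "e = (i, j)" and "i \<in> Q" "j \<in> J" using e by blast
      then have ij: "e = (i, j)" "i \<in> {1..q}" "j \<in> {1..d}" "i \<in> Q" using Q(1) J(1) by blast+
      have "fst c i = fst a i" "snd c j = snd a j" using ga ij(4) by auto
      then have "U.prob {\<omega> \<in> space M. E i j \<omega>} = p (fst c i) (snd c j)"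
        using prob_cond_measure[OF subset_refl edge_event[OF ij(2,3)], of a] edge_prob[OF a ij(2,3)] by simp
      moreover have "E i j -` {False} \<inter> space ?U = {\<omega> \<in> space M. \<not> E i j \<omega>}" unfolding spU by auto
      ultimately show ?thesis
        using U.prob_neg[of "\<lambda>\<omega>. E i j \<omega>"] edge_event[OF ij(2,3)]
        unfolding spU seU ij(1) by simp
    qed
    have sub: "Q \<times> J \<subseteq> {1..q} \<times> {1..d}" using Q J by auto
    have "\<P>(\<omega> in M. \<forall>j\<in>J. hit E Q j \<omega> = 0 \<bar> ?C \<omega> = a) = U.prob {\<omega> \<in> space M. \<forall>j\<in>J. hit E Q j \<omega> = 0}"
      using prob_cond_measure[OF subset_refl ev] by simp
    also have "{\<omega> \<in> space M. \<forall>j\<in>J. hit E Q j \<omega> = 0}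
        = (\<Inter>e\<in>Q \<times> J. (case e of (i, j) \<Rightarrow> E i j) -` {False} \<inter> space ?U)"
      unfolding no_hit using Q(2) J(2) unfolding spU by auto
    also have "U.prob \<dots> = (\<Prod>e\<in>Q \<times> J. U.prob ((case e of (i, j) \<Rightarrow> E i j) -` {False} \<inter> space ?U))"
      using U.indep_varsD[OF edge_indep[OF a], of "Q \<times> J" "\<lambda>_. {False}"] fin Q(2) J(2) sub by simp
    also have "\<dots> = (\<Prod>e\<in>Q \<times> J. 1 - p (fst c (fst e)) (snd c (snd e)))"
      by (intro prod.cong no_edge) auto
    also have "\<dots> = (\<Prod>i\<in>Q. \<Prod>j\<in>J. 1 - p (fst c i) (snd c j))"
      by (simp add: prod.cartesian_product case_prod_beta)
    also have "\<dots> = (\<Prod>j\<in>J. \<Prod>i\<in>Q. 1 - p (fst c i) (snd c j))" by (rule prod.swap)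
    also have "\<dots> = (\<Prod>j\<in>J. 1 - hit_prob M s t E d Q j c)"
      using J(1) by (intro prod.cong) (auto simp: hit_prob_eq[OF Q _ c] subset_iff)
    finally show ?thesis .
  qed
  moreover have "\<P>(\<omega> in M. ?g (?C \<omega>)) > 0"
    using c unfolding g by (simp add: realisations_def config_prob_def)
  ultimately show ?thesis
    using total_probability[OF ev, of ?g] unfolding g by blast
qed

lemma bernoulli_weighted_sum_hits:
  assumes Q: "Q \<subseteq> {1..q}" "Q \<noteq> {}" and c: "c \<in> realisations M s t K L Q d"
    and var: "(\<Sum>j=1..d. (y j)\<^sup>2 * hit_prob M s t E d Q j c * (1 - hit_prob M s t E d Q j c)) = 1"
  shows "bernoulli_weighted_sum (cond_measure M s t Q d c) {1..d} (hit E Q) (\<lambda>j. hit_prob M s t E d Q j c) y"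
proof -
  let ?U = "cond_measure M s t Q d c"
  interpret U: prob_space ?U using prob_space_cond_measure[OF Q(1) c] .
  have fin: "finite Q" using Q finite_subset by blast
  have spU: "space ?U = space M" and seU: "sets ?U = events"
    by (simp_all add: cond_measure_def)
  have zero_one: "hit E Q j \<omega> \<in> {0, 1}" for j \<omega>
    unfolding hit_eq[OF fin Q(2)] of_bool_def by simp
  have rv: "hit E Q j \<in> borel_measurable ?U" if "j \<in> {1..d}" for j
    using hit_measurable[OF Q that] seU by (simp cong: measurable_cong_sets)
  have ev: "{\<omega> \<in> space M. hit E Q j \<omega> = r} \<in> events" if "j \<in> {1..d}" for j r
    using hit_measurable[OF Q that] by measurable
  have p1: "U.prob {\<omega> \<in> space M. hit E Q j \<omega> = 1} = hit_prob M s t E d Q j c" if "j \<in> {1..d}" for j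
    using prob_cond_measure[OF Q(1) ev[OF that]] by (simp add: hit_prob_def)
  have no_hits: "U.prob {\<omega> \<in> space M. \<forall>j\<in>J. hit E Q j \<omega> = 0} = (\<Prod>j\<in>J. 1 - hit_prob M s t E d Q j c)"
    if J: "J \<subseteq> {1..d}" "J \<noteq> {}" for J
  proof -
    have "finite J" using J finite_subset by blast
    then have "{\<omega> \<in> space M. \<forall>j\<in>J. hit E Q j \<omega> = 0} \<in> events"
    proof (rule sets.sets_Collect_finite_All[rotated])
      fix j assume "j \<in> J"
      then show "{\<omega> \<in> space M. hit E Q j \<omega> = 0} \<in> events" using ev J(1) by blast
    qed
    then show ?thesis using prob_cond_measure[OF Q(1)] cond_prob_no_hits[OF Q J c] by simp
  qed
  have "U.indep_vars (\<lambda>_. borel) (hit E Q) {1..d}"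
  proof (rule U.indep_vars_zero_one)
    fix J assume J: "J \<subseteq> {1..d}" "finite J" "J \<noteq> {}"
    have "U.prob {\<omega> \<in> space ?U. hit E Q j \<omega> = 0} = 1 - hit_prob M s t E d Q j c" if "j \<in> J" for j
      using no_hits[of "{j}"] that J unfolding spU by auto
    then show "U.prob {\<omega> \<in> space ?U. \<forall>j\<in>J. hit E Q j \<omega> = 0}
        = (\<Prod>j\<in>J. U.prob {\<omega> \<in> space ?U. hit E Q j \<omega> = 0})"
      using no_hits[OF J(1,3)] unfolding spU by (simp cong: prod.cong)
  qed (use rv zero_one in auto)
  moreover have "U.expectation (hit E Q j) = hit_prob M s t E d Q j c" if "j \<in> {1..d}" for j
  proof -
    have "U.expectation (hit E Q j) = U.expectation (indicat_real {\<omega> \<in> space M. hit E Q j \<omega> = 1})"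
      using zero_one by (intro Bochner_Integration.integral_cong) (auto simp: spU indicator_def)
    also have "\<dots> = hit_prob M s t E d Q j c"
      using p1[OF that] ev[OF that] by (simp add: spU Int_def conj_commute)
    finally show ?thesis .
  qed
  ultimately show ?thesis
    using zero_one var by unfold_locales auto
qed

lemma prob_eq_sum_config:
  assumes Q: "Q \<subseteq> {1..q}" and A: "{\<omega> \<in> space M. A \<omega>} \<in> events"
  shows "\<P>(\<omega> in M. A \<omega>)
    = (\<Sum>c\<in>realisations M s t K L Q d. config_prob M s t Q d c * measure (cond_measure M s t Q d c) {\<omega> \<in> space M. A \<omega>})"
proof -
  let ?F = "(Q \<rightarrow>\<^sub>E {1..K}) \<times> ({1..d} \<rightarrow>\<^sub>E {1..L})" and ?C = "config s t Q d"
  have ev: "{\<omega> \<in> space M. A \<omega> \<and> ?C \<omega> = c} \<in> events" for c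
    using sets.sets_Collect_conj[OF config_event[OF Q] A] by (simp add: conj_commute)
  have "{\<omega> \<in> space M. A \<omega>} = (\<Union>c\<in>?F. {\<omega> \<in> space M. A \<omega> \<and> ?C \<omega> = c})"
    using config_range[OF Q] by auto
  moreover have "prob \<dots> = (\<Sum>c\<in>?F. \<P>(\<omega> in M. A \<omega> \<and> ?C \<omega> = c))"
    using ev by (intro finite_measure_finite_Union finite_configs[OF Q]) (auto simp: disjoint_family_on_def)
  ultimately have "\<P>(\<omega> in M. A \<omega>) = (\<Sum>c\<in>?F. \<P>(\<omega> in M. A \<omega> \<and> ?C \<omega> = c))"
    by simp
  also have "\<dots> = (\<Sum>c\<in>realisations M s t K L Q d. \<P>(\<omega> in M. A \<omega> \<and> ?C \<omega> = c))"
  proof (rule sum.mono_neutral_right[OF finite_configs[OF Q]])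
    show "\<forall>c\<in>?F - realisations M s t K L Q d. \<P>(\<omega> in M. A \<omega> \<and> ?C \<omega> = c) = 0"
    proof
      fix c assume "c \<in> ?F - realisations M s t K L Q d"
      then have "\<P>(\<omega> in M. ?C \<omega> = c) = 0"
        by (auto simp: realisations_def config_prob_def zero_less_measure_iff)
      moreover have "\<P>(\<omega> in M. A \<omega> \<and> ?C \<omega> = c) \<le> \<P>(\<omega> in M. ?C \<omega> = c)"
        by (rule finite_measure_mono) (use config_event[OF Q, of c] in auto)
      ultimately show "\<P>(\<omega> in M. A \<omega> \<and> ?C \<omega> = c) = 0" by (simp add: measure_le_0_iff)
    qed
  qed (auto simp: realisations_def)
  also have "\<dots> = (\<Sum>c\<in>realisations M s t K L Q d. config_prob M s t Q d c * measure (cond_measure M s t Q d c) {\<omega> \<in> space M. A \<omega>})"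
    by (intro sum.cong refl)
      (simp add: prob_cond_measure[OF Q A] cond_prob_def config_prob_def realisations_def)
  finally show ?thesis .
qed

text \<open>
  Multiplying out, \<open>PK < 1\<close> is equivalent to \<open>S > 0\<close> as soon as the denominator is not zero. It is
  zero only if there are no hits; then \<open>PK = 0 < 1\<close> although \<open>S = 0\<close>, so \<open>PK < 1\<close> yields only
  \<open>0 \<le> S\<close>.
\<close>

lemma PK_less_1:
  assumes Q: "Q \<subseteq> {1..q}" "Q \<noteq> {}"
    and pos: "\<And>j. j \<in> {1..d} \<Longrightarrow> prem j > 0" "\<And>j. j \<in> {1..d} \<Longrightarrow> mu j > 0" "lam > 0"
  defines "S \<equiv> \<lambda>\<omega>. \<Sum>j=1..d. (xi lam prem mu j - 1) * hit E Q j \<omega>"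
  shows "0 < S \<omega> \<Longrightarrow> PK lam prem mu d E Q \<omega> < 1"
    and "PK lam prem mu d E Q \<omega> < 1 \<Longrightarrow> 0 \<le> S \<omega>"
proof -
  let ?H = "\<Sum>j=1..d. hit E Q j \<omega>" and ?D = "\<Sum>j=1..d. hit E Q j \<omega> * (prem j / mu j)"
  have fin: "finite Q" using Q finite_subset by blast
  have hit: "0 \<le> hit E Q j \<omega>" for j by (simp add: hit_eq[OF fin Q(2)])
  have "S \<omega> = (\<Sum>j=1..d. hit E Q j \<omega> * (prem j / mu j) / lam - hit E Q j \<omega>)"
    unfolding S_def xi_def using pos(3) by (intro sum.cong refl) (simp add: field_simps)
  then have S: "S \<omega> = ?D / lam - ?H" by (simp add: sum_subtractf sum_divide_distrib)
  have nn: "0 \<le> hit E Q j \<omega> * (prem j / mu j)" if "j \<in> {1..d}" for j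
    using hit pos(1,2)[OF that] by simp
  have D: "0 \<le> ?D" by (rule sum_nonneg[OF nn])
  have H0: "?H = 0" if "?D = 0"
  proof (rule sum.neutral, rule ballI)
    fix j assume j: "j \<in> {1..d}"
    have "hit E Q j \<omega> * (prem j / mu j) = 0"
      using sum_nonneg_eq_0_iff[of "{1..d}" "\<lambda>j. hit E Q j \<omega> * (prem j / mu j)"] nn that j by blast
    then show "hit E Q j \<omega> = 0" using pos(1,2)[OF j] by simp
  qed
  have PK: "PK lam prem mu d E Q \<omega> = lam * (?H / ?D)" by (simp add: PK_def)
  have iff: "PK lam prem mu d E Q \<omega> < 1 \<longleftrightarrow> 0 < S \<omega>" if "?D \<noteq> 0"
    using that D pos(3) unfolding PK S by (simp add: field_simps)
  have S0: "S \<omega> = 0" if "?D = 0" unfolding S using that H0 by simp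
  show "0 < S \<omega> \<Longrightarrow> PK lam prem mu d E Q \<omega> < 1" using iff S0 by fastforce
  show "PK lam prem mu d E Q \<omega> < 1 \<Longrightarrow> 0 \<le> S \<omega>" using iff S0 by fastforce
qed

lemma PK_event:
  assumes Q: "Q \<subseteq> {1..q}" "Q \<noteq> {}"
  shows "{\<omega> \<in> space M. PK lam prem mu d E Q \<omega> < 1} \<in> events"
proof -
  note [measurable] = hit_measurable[OF Q]
  show ?thesis unfolding PK_def by measurable
qed

text \<open>
  The lower estimate uses the Berry--Esseen bound for the standardised \<open>S\<close>, through
  \<open>S > 0 \<Longrightarrow> PK < 1\<close>. The upper estimate needs the closed event \<open>S \<ge> 0\<close>, whose
  probability is a value of the distribution function of \<open>- S\<close> and not of that of \<open>S\<close>. Hence the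
  sign \<open>e\<close>.
\<close>

lemma cond_PK_normal_approximation:
  fixes prem mu :: "nat \<Rightarrow> real" and lam :: real
  assumes Q: "Q \<subseteq> {1..q}" "Q \<noteq> {}" and c: "c \<in> realisations M s t K L Q d"
    and pos: "\<And>j. j \<in> {1..d} \<Longrightarrow> prem j > 0" "\<And>j. j \<in> {1..d} \<Longrightarrow> mu j > 0" "lam > 0"
  defines "U \<equiv> cond_measure M s t Q d c" and "x \<equiv> xi lam prem mu"
    and "pr \<equiv> \<lambda>j. hit_prob M s t E d Q j c"
  assumes var: "0 < var_of x d pr"
  shows "\<bar>measure U {\<omega> \<in> space M. PK lam prem mu d E Q \<omega> < 1} - Phi (mean_of x d pr / sqrt (var_of x d pr))\<bar>
    \<le> 9.4 * (\<Sum>j=1..d. \<integral>\<omega>. \<bar>Z_of x d pr E Q j \<omega>\<bar> ^ 3 \<partial>U)"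
proof -
  define \<sigma> where "\<sigma> = sqrt (var_of x d pr)"
  have \<sigma>: "0 < \<sigma>" "\<sigma>\<^sup>2 = var_of x d pr" using var by (simp_all add: \<sigma>_def)
  let ?m = "mean_of x d pr"
  let ?S = "\<lambda>\<omega>. \<Sum>j=1..d. (x j - 1) * hit E Q j \<omega>"
  let ?g = "\<Sum>j=1..d. \<integral>\<omega>. \<bar>Z_of x d pr E Q j \<omega>\<bar> ^ 3 \<partial>U"
  interpret U: prob_space U unfolding U_def using prob_space_cond_measure[OF Q(1) c] .
  have spU: "space U = space M" and seU: "sets U = events"
    by (simp_all add: cond_measure_def U_def)
  have unit: "(\<Sum>j=1..d. (e * (x j - 1) / \<sigma>)\<^sup>2 * pr j * (1 - pr j)) = 1" if "e\<^sup>2 = 1" for e :: real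
  proof -
    have "(\<Sum>j=1..d. (e * (x j - 1) / \<sigma>)\<^sup>2 * pr j * (1 - pr j)) = var_of x d pr / \<sigma>\<^sup>2"
      using that by (simp add: var_of_def sum_divide_distrib power_divide power_mult_distrib)
    then show ?thesis using \<sigma> var by simp
  qed
  have BE: "\<bar>U.prob {\<omega> \<in> space M. e * (?S \<omega> - ?m) / \<sigma> \<le> z} - Phi z\<bar> \<le> 9.4 * ?g" if e: "e\<^sup>2 = 1" for e z :: real
  proof -
    interpret B: bernoulli_weighted_sum U "{1..d}" "hit E Q" pr "\<lambda>j. e * (x j - 1) / \<sigma>"
      unfolding U_def pr_def
      by (rule bernoulli_weighted_sum_hits[OF Q c]) (rule unit[OF e, unfolded pr_def])
    have W: "B.W \<omega> = e * (?S \<omega> - ?m) / \<sigma>" for \<omega>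
      unfolding B.W_def mean_of_def
      by (simp add: sum_subtractf[symmetric] sum_distrib_left sum_divide_distrib algebra_simps diff_divide_distrib add_divide_distrib)
    have "\<bar>e * (x j - 1) / \<sigma> * (hit E Q j \<omega> - pr j)\<bar> = \<bar>Z_of x d pr E Q j \<omega>\<bar>" for j \<omega>
    proof -
      have "\<bar>e\<bar> = 1" using e by (auto simp: power2_eq_1_iff)
      then show ?thesis by (simp add: Z_of_def abs_mult \<sigma>_def)
    qed
    then show ?thesis using B.berry_esseen_third_moments[of z] unfolding W spU by simp
  qed
  have S_meas: "?S \<in> borel_measurable U"
    using hit_measurable[OF Q] seU by (auto cong: measurable_cong_sets)
  note [measurable] = S_meas
  have PKev: "{\<omega> \<in> space M. PK lam prem mu d E Q \<omega> < 1} \<in> sets U"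
    using PK_event[OF Q] seU by simp
  have PK: "0 < ?S \<omega> \<Longrightarrow> PK lam prem mu d E Q \<omega> < 1"
    "PK lam prem mu d E Q \<omega> < 1 \<Longrightarrow> 0 \<le> ?S \<omega>" for \<omega>
    using PK_less_1[OF Q, of prem mu lam \<omega>] pos unfolding x_def by blast+
  have minus_one_sq: "(- 1 :: real)\<^sup>2 = 1" by simp
  have ge: "{\<omega> \<in> space U. 0 \<le> ?S \<omega>} \<in> sets U"
    by measurable
  have "1 - U.prob {\<omega> \<in> space M. 1 * (?S \<omega> - ?m) / \<sigma> \<le> - (?m / \<sigma>)}
      = U.prob {\<omega> \<in> space U. \<not> 1 * (?S \<omega> - ?m) / \<sigma> \<le> - (?m / \<sigma>)}"
    unfolding spU[symmetric] by (rule U.prob_neg[symmetric]) measurable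
  also have "{\<omega> \<in> space U. \<not> 1 * (?S \<omega> - ?m) / \<sigma> \<le> - (?m / \<sigma>)} = {\<omega> \<in> space U. 0 < ?S \<omega>}"
    using \<sigma> by (auto simp: field_simps mult_le_0_iff)
  also have "U.prob \<dots> \<le> U.prob {\<omega> \<in> space M. PK lam prem mu d E Q \<omega> < 1}"
    using PK(1) PKev by (intro U.finite_measure_mono) (auto simp: spU)
  finally have lower: "Phi (?m / \<sigma>) - 9.4 * ?g \<le> U.prob {\<omega> \<in> space M. PK lam prem mu d E Q \<omega> < 1}"
    using BE[OF one_power2, of "- (?m / \<sigma>)"] unfolding Phi_uminus abs_le_iff by linarith
  have "U.prob {\<omega> \<in> space M. PK lam prem mu d E Q \<omega> < 1} \<le> U.prob {\<omega> \<in> space U. 0 \<le> ?S \<omega>}"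
    using PK(2) ge by (intro U.finite_measure_mono) (auto simp: spU)
  also have "{\<omega> \<in> space U. 0 \<le> ?S \<omega>} = {\<omega> \<in> space M. (- 1) * (?S \<omega> - ?m) / \<sigma> \<le> ?m / \<sigma>}"
    using \<sigma>(1) by (simp add: spU divide_le_cancel)
  finally have "U.prob {\<omega> \<in> space M. PK lam prem mu d E Q \<omega> < 1} \<le> Phi (?m / \<sigma>) + 9.4 * ?g"
    using BE[OF minus_one_sq, of "?m / \<sigma>"] unfolding abs_le_iff by linarith
  with lower show ?thesis unfolding \<sigma>_def abs_le_iff by linarith
qed

end

section \<open>Normal approximation of the probability that the Pollaczek--Khintchine variable is below one\<close>

theorem theorem3p1:
  fixes M :: "'w measure"
    and q d K L :: nat
    and w v :: "nat \<Rightarrow> real"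
    and p :: "nat \<Rightarrow> nat \<Rightarrow> real"
    and s t :: "nat \<Rightarrow> 'w \<Rightarrow> nat"
    and E :: "nat \<Rightarrow> nat \<Rightarrow> 'w \<Rightarrow> bool"
    and prem mu :: "nat \<Rightarrow> real"
    and lam :: real
    and Q :: "nat set"
    and M' :: "'b measure"
    and Nc :: "type_config \<Rightarrow> 'b \<Rightarrow> real"
    and N :: "'b \<Rightarrow> real"
  defines "R \<equiv> realisations M s t K L Q d"
    and "P \<equiv> config_prob M s t Q d"
    and "x \<equiv> xi lam prem mu"
    and "pc \<equiv> (\<lambda>c j. hit_prob M s t E d Q j c)"
  assumes model: "bipartite_blockmodel M q d K L w v p s t E"
    and prem_pos: "\<And>j. j \<in> {1..d} \<Longrightarrow> prem j > 0"
    and mu_pos: "\<And>j. j \<in> {1..d} \<Longrightarrow> mu j > 0"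
    and lam_pos: "lam > 0"
    and Q_subset: "Q \<subseteq> {1..q}"
    and Q_nonempty: "Q \<noteq> {}"
    and var_pos: "\<And>c. c \<in> R \<Longrightarrow> var_of x d (pc c) > 0"
    and prob_M': "prob_space M'"
    and Nc_normal: "\<And>c. c \<in> R \<Longrightarrow> distributed M' lborel (Nc c)
          (normal_density (mean_of x d (pc c)) (sqrt (var_of x d (pc c))))"
    and N_measurable: "N \<in> borel_measurable M'"
    and N_mixture: "\<And>A. A \<in> sets borel \<Longrightarrow>
          \<P>(y in M'. N y \<in> A) = (\<Sum>c\<in>R. P c * \<P>(y in M'. Nc c y \<in> A))"
  shows "\<bar>\<P>(\<omega> in M. PK lam prem mu d E Q \<omega> < 1) - \<P>(y in M'. N y > 0)\<bar>
    \<le> 9.4 * (\<Sum>c\<in>R. P c *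
          (\<Sum>j=1..d. \<integral>\<omega>. \<bar>Z_of x d (pc c) E Q j \<omega>\<bar> ^ 3 \<partial>(cond_measure M s t Q d c)))"
proof -
  interpret bipartite_blockmodel M q d K L w v p s t E by (rule model)
  let ?U = "cond_measure M s t Q d"
  let ?A = "{\<omega> \<in> space M. PK lam prem mu d E Q \<omega> < 1}"
  let ?phi = "\<lambda>c. Phi (mean_of x d (pc c) / sqrt (var_of x d (pc c)))"
  let ?g = "\<lambda>c. \<Sum>j=1..d. \<integral>\<omega>. \<bar>Z_of x d (pc c) E Q j \<omega>\<bar> ^ 3 \<partial>(?U c)"
  have PK: "\<P>(\<omega> in M. PK lam prem mu d E Q \<omega> < 1) = (\<Sum>c\<in>R. P c * measure (?U c) ?A)"
    unfolding R_def P_def by (rule prob_eq_sum_config[OF Q_subset PK_event[OF Q_subset Q_nonempty]])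
  have "\<P>(y in M'. N y > 0) = (\<Sum>c\<in>R. P c * \<P>(y in M'. Nc c y > 0))"
    using N_mixture[of "{0<..}"] by simp
  also have "\<dots> = (\<Sum>c\<in>R. P c * ?phi c)"
    using prob_space.normal_prob_greater_0[OF prob_M' Nc_normal] var_pos by (intro sum.cong) auto
  finally have N: "\<P>(y in M'. N y > 0) = (\<Sum>c\<in>R. P c * ?phi c)" .
  have "\<bar>\<P>(\<omega> in M. PK lam prem mu d E Q \<omega> < 1) - \<P>(y in M'. N y > 0)\<bar>
      = \<bar>\<Sum>c\<in>R. P c * (measure (?U c) ?A - ?phi c)\<bar>"
    unfolding PK N by (simp add: right_diff_distrib sum_subtractf)
  also have "\<dots> \<le> (\<Sum>c\<in>R. \<bar>P c * (measure (?U c) ?A - ?phi c)\<bar>)" by (rule sum_abs)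
  also have "\<dots> \<le> (\<Sum>c\<in>R. P c * (9.4 * ?g c))"
  proof (rule sum_mono)
    fix c assume c: "c \<in> R"
    have "\<bar>measure (?U c) ?A - ?phi c\<bar> \<le> 9.4 * ?g c"
      using cond_PK_normal_approximation[OF Q_subset Q_nonempty _ prem_pos mu_pos lam_pos, of c]
        c var_pos[OF c] unfolding R_def x_def pc_def by simp
    moreover have "0 \<le> P c" by (simp add: P_def config_prob_def)
    ultimately show "\<bar>P c * (measure (?U c) ?A - ?phi c)\<bar> \<le> P c * (9.4 * ?g c)"
      unfolding abs_mult by (simp only: abs_of_nonneg mult_left_mono)
  qed
  also have "\<dots> = 9.4 * (\<Sum>c\<in>R. P c * ?g c)" by (simp add: sum_distrib_left mult_ac)
  finally show ?thesis .
qed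

end
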